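(* There is no positive definite affine hypersurface $F:M^3\to\mathbb{R}^4$ admitting a pointwise "$Z_2\times SO(2)$"-symmetry, i.e. such that at every point $p\in M^3$ the stabilizer $G_p$ is the group generated by all rotations about some line $\ell_p\subset T_pM$ together with a rotation by $\pi$ about a line orthogonal to $\ell_p$.
   Context: A nondegenerate affine hypersurface $F:M^3\to\mathbb{R}^4$ is an immersion which carries the (equi)affine (Blaschke) normal field $\xi$, inducing $\nabla$, $h$, $S$ by $D_XY=\nabla_XY+h(X,Y)\xi$, $D_X\xi=-SX$ ($D$ the flat connection of $\mathbb{R}^4$), where $h$ (affine metric) is nondegenerate and $|\det(X_1,X_2,X_3,\xi)|=1$ for $h$-orthonormal $X_1,X_2,X_3$; $S$ is the affine shape operator. The difference tensor is $K(X,Y)=\nabla_XY-\widehat\nabla_XY$, with $\widehat\nabla$ the Levi-Civita connection of $h$; $h(K(X,Y),Z)$ is totally symmetric and $\operatorname{trace}K_X=0$. The hypersurface is positive definite if $h$ is positive definite. For $p\in M$, $G_p$ is the group of orientation-preserving linear isometries $g$ of $(T_pM,h)$ satisfying $K(gX,gY)=gK(X,Y)$ and $S(gX)=gS(X)$ for all $X,Y\in T_pM$. *)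

theory Defs
  imports "HOL-Analysis.Analysis" "HOL-Algebra.Bij" "HOL-Algebra.Generated_Groups"
begin

section \<open>Smooth maps and smooth manifolds\<close>

primrec Ck_on :: "nat \<Rightarrow> 'a::real_normed_vector set \<Rightarrow> ('a \<Rightarrow> 'b::real_normed_vector) \<Rightarrow> bool"
  where
    "Ck_on 0 V f \<longleftrightarrow> continuous_on V f"
  | "Ck_on (Suc k) V f \<longleftrightarrow>
       (\<forall>x\<in>V. f differentiable (at x)) \<and>
       (\<forall>v. Ck_on k V (\<lambda>x. frechet_derivative f (at x) v))"

text \<open>Only used for open subsets \<open>V\<close> of finite-dimensional spaces.\<close>

definition smooth_on :: "'a::real_normed_vector set \<Rightarrow> ('a \<Rightarrow> 'b::real_normed_vector) \<Rightarrow> bool"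
  where "smooth_on V f \<longleftrightarrow> (\<forall>k. Ck_on k V f)"

type_synonym 'a chart = "'a set \<times> ('a \<Rightarrow> real^3)"

definition smooth_3_manifold :: "'a topology \<Rightarrow> 'a chart set \<Rightarrow> bool"
  where "smooth_3_manifold X A \<longleftrightarrow>
    topspace X \<noteq> {} \<and> Hausdorff_space X \<and> second_countable X \<and>
    (\<Union>(U, \<phi>)\<in>A. U) = topspace X \<and>
    (\<forall>(U, \<phi>)\<in>A. openin X U \<and> open (\<phi> ` U) \<and>
       homeomorphic_map (subtopology X U) (top_of_set (\<phi> ` U)) \<phi>) \<and>
    (\<forall>(U, \<phi>)\<in>A. \<forall>(U', \<phi>')\<in>A.
       smooth_on (\<phi> ` (U \<inter> U')) (\<lambda>x. \<phi>' (inv_into U \<phi> x)))"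

definition in_chart :: "'a chart \<Rightarrow> ('a \<Rightarrow> 'b) \<Rightarrow> real^3 \<Rightarrow> 'b"
  where "in_chart c F = (\<lambda>x. F (inv_into (fst c) (snd c) x))"

definition chart_image :: "'a chart \<Rightarrow> (real^3) set"
  where "chart_image c = snd c ` fst c"

section \<open>Local affine hypersurface theory\<close>

text \<open>
  Throughout, \<open>V\<close> is the image of a chart, \<open>f\<close> and \<open>\<xi>\<close> are the immersion and the transversal
  field in that chart, tangent spaces are identified with \<open>real^3\<close> by the chart, and vector
  fields are maps \<open>real^3 \<Rightarrow> real^3\<close> of which only the values on \<open>V\<close> matter.
\<close>

type_synonym vfield = "real^3 \<Rightarrow> real^3"

definition transversal_immersion :: "(real^3) set \<Rightarrow> (real^3 \<Rightarrow> real^4) \<Rightarrow> (real^3 \<Rightarrow> real^4) \<Rightarrow> bool"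
  where "transversal_immersion V f \<xi> \<longleftrightarrow>
    (\<forall>x\<in>V. inj (frechet_derivative f (at x)) \<and> \<xi> x \<notin> range (frechet_derivative f (at x)))"

text \<open>The components of \<open>w = df(t) + a \<xi>\<close>; unique for a transversal immersion.\<close>

definition tangential_part :: "(real^3 \<Rightarrow> real^4) \<Rightarrow> (real^3 \<Rightarrow> real^4) \<Rightarrow> real^3 \<Rightarrow> real^4 \<Rightarrow> real^3"
  where "tangential_part f \<xi> x w = (THE t. \<exists>a. w = frechet_derivative f (at x) t + a *\<^sub>R \<xi> x)"

definition transversal_part :: "(real^3 \<Rightarrow> real^4) \<Rightarrow> (real^3 \<Rightarrow> real^4) \<Rightarrow> real^3 \<Rightarrow> real^4 \<Rightarrow> real"
  where "transversal_part f \<xi> x w = (THE a. \<exists>t. w = frechet_derivative f (at x) t + a *\<^sub>R \<xi> x)"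

text \<open>The derivative \<open>D\<^sub>X (df(Y))\<close> with respect to the flat connection of \<open>real^4\<close>.\<close>

definition flat_deriv :: "(real^3 \<Rightarrow> real^4) \<Rightarrow> vfield \<Rightarrow> vfield \<Rightarrow> real^3 \<Rightarrow> real^4"
  where "flat_deriv f X Y x =
    frechet_derivative (\<lambda>y. frechet_derivative f (at y) (Y y)) (at x) (X x)"

definition induced_connection :: "(real^3 \<Rightarrow> real^4) \<Rightarrow> (real^3 \<Rightarrow> real^4) \<Rightarrow> vfield \<Rightarrow> vfield \<Rightarrow> vfield"
  where "induced_connection f \<xi> X Y x = tangential_part f \<xi> x (flat_deriv f X Y x)"

text \<open>
  The affine metric is tensorial, so its value on two tangent vectors is computed by extending
  them to fields that are constant in the chart.
\<close>

definition affine_metric :: "(real^3 \<Rightarrow> real^4) \<Rightarrow> (real^3 \<Rightarrow> real^4) \<Rightarrow> real^3 \<Rightarrow> real^3 \<Rightarrow> real^3 \<Rightarrow> real"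
  where "affine_metric f \<xi> x u v = transversal_part f \<xi> x (flat_deriv f (\<lambda>_. u) (\<lambda>_. v) x)"

definition shape_operator :: "(real^3 \<Rightarrow> real^4) \<Rightarrow> (real^3 \<Rightarrow> real^4) \<Rightarrow> real^3 \<Rightarrow> real^3 \<Rightarrow> real^3"
  where "shape_operator f \<xi> x u = - tangential_part f \<xi> x (frechet_derivative \<xi> (at x) u)"

definition nondegenerate_form :: "(real^3 \<Rightarrow> real^3 \<Rightarrow> real) \<Rightarrow> bool"
  where "nondegenerate_form b \<longleftrightarrow> (\<forall>u. (\<forall>v. b u v = 0) \<longrightarrow> u = 0)"

text \<open>
  \<open>\<xi>\<close> is an affine (Blaschke) normal field: \<open>D\<^sub>X \<xi>\<close> is tangent, and \<open>\<bar>det(X\<^sub>1, X\<^sub>2, X\<^sub>3, \<xi>)\<bar> = 1\<close> for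
  orthonormal \<open>X\<^sub>1, X\<^sub>2, X\<^sub>3\<close>, where vectors in an orthonormal basis of an indefinite metric may
  have square \<open>-1\<close>.
\<close>

definition blaschke_normal :: "(real^3) set \<Rightarrow> (real^3 \<Rightarrow> real^4) \<Rightarrow> (real^3 \<Rightarrow> real^4) \<Rightarrow> bool"
  where "blaschke_normal V f \<xi> \<longleftrightarrow>
    (\<forall>x\<in>V. range (frechet_derivative \<xi> (at x)) \<subseteq> range (frechet_derivative f (at x)) \<and>
       nondegenerate_form (affine_metric f \<xi> x) \<and>
       (\<forall>e :: 3 \<Rightarrow> real^3.
          (\<forall>i. \<bar>affine_metric f \<xi> x (e i) (e i)\<bar> = 1) \<and>
          (\<forall>i j. i \<noteq> j \<longrightarrow> affine_metric f \<xi> x (e i) (e j) = 0) \<longrightarrow>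
          \<bar>det (vector [frechet_derivative f (at x) (e 1), frechet_derivative f (at x) (e 2),
                         frechet_derivative f (at x) (e 3), \<xi> x] :: real^4^4)\<bar> = 1))"

section \<open>The Levi-Civita connection and the difference tensor\<close>

definition lie_bracket :: "vfield \<Rightarrow> vfield \<Rightarrow> vfield"
  where "lie_bracket X Y x =
    frechet_derivative Y (at x) (X x) - frechet_derivative X (at x) (Y x)"

definition affine_connection :: "(real^3) set \<Rightarrow> (vfield \<Rightarrow> vfield \<Rightarrow> vfield) \<Rightarrow> bool"
  where "affine_connection V L \<longleftrightarrow>
    (\<forall>X Y. smooth_on V X \<and> smooth_on V Y \<longrightarrow> smooth_on V (L X Y)) \<and>
    (\<forall>X X' Y. smooth_on V X \<and> smooth_on V X' \<and> smooth_on V Y \<longrightarrow>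
       (\<forall>x\<in>V. L (\<lambda>y. X y + X' y) Y x = L X Y x + L X' Y x)) \<and>
    (\<forall>X Y Y'. smooth_on V X \<and> smooth_on V Y \<and> smooth_on V Y' \<longrightarrow>
       (\<forall>x\<in>V. L X (\<lambda>y. Y y + Y' y) x = L X Y x + L X Y' x)) \<and>
    (\<forall>(a :: real^3 \<Rightarrow> real) X Y. smooth_on V a \<and> smooth_on V X \<and> smooth_on V Y \<longrightarrow>
       (\<forall>x\<in>V. L (\<lambda>y. a y *\<^sub>R X y) Y x = a x *\<^sub>R L X Y x \<and>
          L X (\<lambda>y. a y *\<^sub>R Y y) x =
            a x *\<^sub>R L X Y x + frechet_derivative a (at x) (X x) *\<^sub>R Y x))"

definition levi_civita :: "(real^3) set \<Rightarrow> (real^3 \<Rightarrow> real^3 \<Rightarrow> real^3 \<Rightarrow> real)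
    \<Rightarrow> (vfield \<Rightarrow> vfield \<Rightarrow> vfield) \<Rightarrow> bool"
  where "levi_civita V h L \<longleftrightarrow> affine_connection V L \<and>
    (\<forall>X Y. smooth_on V X \<and> smooth_on V Y \<longrightarrow>
       (\<forall>x\<in>V. L X Y x - L Y X x = lie_bracket X Y x)) \<and>
    (\<forall>X Y Z. smooth_on V X \<and> smooth_on V Y \<and> smooth_on V Z \<longrightarrow>
       (\<forall>x\<in>V. frechet_derivative (\<lambda>y. h y (Y y) (Z y)) (at x) (X x) =
          h x (L X Y x) (Z x) + h x (Y x) (L X Z x)))"

text \<open>
  \<open>K(X, Y) = \<nabla>\<^sub>X Y - L\<^sub>X Y\<close> for the Levi-Civita connection \<open>L\<close>; it is tensorial, hence again evaluated
  on fields that are constant in the chart.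
\<close>

definition difference_tensor :: "(real^3 \<Rightarrow> real^4) \<Rightarrow> (real^3 \<Rightarrow> real^4)
    \<Rightarrow> (vfield \<Rightarrow> vfield \<Rightarrow> vfield) \<Rightarrow> real^3 \<Rightarrow> real^3 \<Rightarrow> real^3 \<Rightarrow> real^3"
  where "difference_tensor f \<xi> L x u v =
    induced_connection f \<xi> (\<lambda>_. u) (\<lambda>_. v) x - L (\<lambda>_. u) (\<lambda>_. v) x"

section \<open>Symmetry groups\<close>

definition oriented_isometries :: "(real^3 \<Rightarrow> real^3 \<Rightarrow> real) \<Rightarrow> (real^3 \<Rightarrow> real^3) set"
  where "oriented_isometries b =
    {g. linear g \<and> det (matrix g) > 0 \<and> (\<forall>u v. b (g u) (g v) = b u v)}"

definition symmetry_group :: "(real^3 \<Rightarrow> real^3 \<Rightarrow> real) \<Rightarrow> (real^3 \<Rightarrow> real^3 \<Rightarrow> real^3)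
    \<Rightarrow> (real^3 \<Rightarrow> real^3) \<Rightarrow> (real^3 \<Rightarrow> real^3) set"
  where "symmetry_group b K S =
    {g \<in> oriented_isometries b.
       (\<forall>u v. K (g u) (g v) = g (K u v)) \<and> (\<forall>u. S (g u) = g (S u))}"

definition rotations_about :: "(real^3 \<Rightarrow> real^3 \<Rightarrow> real) \<Rightarrow> (real^3) set \<Rightarrow> (real^3 \<Rightarrow> real^3) set"
  where "rotations_about b l = {g \<in> oriented_isometries b. \<forall>u\<in>l. g u = u}"

definition half_turn_about :: "(real^3 \<Rightarrow> real^3 \<Rightarrow> real) \<Rightarrow> (real^3) set \<Rightarrow> (real^3 \<Rightarrow> real^3) \<Rightarrow> bool"
  where "half_turn_about b m r \<longleftrightarrow> linear r \<and> (\<forall>u\<in>m. r u = u) \<and>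
    (\<forall>u. (\<forall>v\<in>m. b u v = 0) \<longrightarrow> r u = - u)"

definition is_Z2_SO2 :: "(real^3 \<Rightarrow> real^3 \<Rightarrow> real) \<Rightarrow> (real^3 \<Rightarrow> real^3) set \<Rightarrow> bool"
  where "is_Z2_SO2 b G \<longleftrightarrow>
    (\<exists>l m r. subspace l \<and> dim l = 1 \<and> subspace m \<and> dim m = 1 \<and>
       (\<forall>u\<in>l. \<forall>v\<in>m. b u v = 0) \<and> half_turn_about b m r \<and>
       G = generate (BijGroup UNIV) (rotations_about b l \<union> {r}))"

section \<open>Affine hypersurfaces\<close>

definition affine_hypersurface :: "'a topology \<Rightarrow> 'a chart set \<Rightarrow> ('a \<Rightarrow> real^4) \<Rightarrow> ('a \<Rightarrow> real^4) \<Rightarrow> bool"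
  where "affine_hypersurface X A F \<xi> \<longleftrightarrow> smooth_3_manifold X A \<and>
    (\<forall>c\<in>A. smooth_on (chart_image c) (in_chart c F) \<and> smooth_on (chart_image c) (in_chart c \<xi>) \<and>
       transversal_immersion (chart_image c) (in_chart c F) (in_chart c \<xi>) \<and>
       blaschke_normal (chart_image c) (in_chart c F) (in_chart c \<xi>))"

definition positive_definite_hypersurface :: "'a chart set \<Rightarrow> ('a \<Rightarrow> real^4) \<Rightarrow> ('a \<Rightarrow> real^4) \<Rightarrow> bool"
  where "positive_definite_hypersurface A F \<xi> \<longleftrightarrow>
    (\<forall>c\<in>A. \<forall>x\<in>chart_image c. \<forall>u. u \<noteq> 0 \<longrightarrow> affine_metric (in_chart c F) (in_chart c \<xi>) x u u > 0)"

text \<open>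
  The condition on \<open>G\<^sub>p\<close> does not depend on the chart used to represent the tangent space at \<open>p\<close>.
  The connection \<open>L\<close> is determined on smooth vector fields, so it is irrelevant that it is
  introduced by an existential quantifier.
\<close>

definition pointwise_Z2_SO2_symmetric :: "'a chart set \<Rightarrow> ('a \<Rightarrow> real^4) \<Rightarrow> ('a \<Rightarrow> real^4) \<Rightarrow> bool"
  where "pointwise_Z2_SO2_symmetric A F \<xi> \<longleftrightarrow>
    (\<forall>c\<in>A. let f = in_chart c F; n = in_chart c \<xi>; V = chart_image c in
       \<exists>L. levi_civita V (affine_metric f n) L \<and>
         (\<forall>x\<in>V. is_Z2_SO2 (affine_metric f n x)
            (symmetry_group (affine_metric f n x) (difference_tensor f n L x) (shape_operator f n x))))"

end

(* Let C(X,Y,Z) = h(K(X,Y),Z). The Codazzi equation makes C totally symmetric, and a totally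
   symmetric cubic form invariant under a quarter turn about l and a half turn about a line
   orthogonal to l vanishes. Hence K = 0 everywhere, so the induced connection is the Levi-Civita
   connection of h; its curvature is skew with respect to h, and by the Gauss equation this forces
   S to be a multiple of the identity at every point. Then every orientation-preserving isometry of
   h is a symmetry, although the group generated by the rotations about l and the half turn
   preserves l. *)
theory Submission
  imports Defs
begin

section \<open>Differential calculus\<close>

text \<open>The algebra that kills \<open>K\<close> works at one point, but the curvature argument
  differentiates \<open>K = 0\<close>, so \<open>K\<close> must vanish on a whole chart before a
  point is fixed. With fields constant in the chart all Lie brackets vanish, and every structure
  equation becomes the symmetry of a mixed derivative. The second derivative of \<open>f\<close>
  gives torsion-freeness and the symmetry of \<open>h\<close>; its third derivative gives the Gauss
  equation (tangential part) and the Codazzi equation (transversal part); the second derivative of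
  the function \<open>h v v\<close> gives the skewness of the curvature. The main analytic input is
  therefore the symmetry of mixed derivatives, under the regularity that \<open>smooth_on\<close>
  provides directly: directional derivatives in fixed directions are again differentiable. The
  objects to be differentiated, \<Gamma> and \<open>h\<close>, are given only by unique existence;
  Cramer's rule makes them differentiable. Skewness leaves h(u,v) h(Sw,v) = h(w,v) h(Su,v); the case
  u = v makes each v an eigenvector of the adjoint of S, and an operator with that property is
  scalar.\<close>

lemma second_difference_tendsto:
  fixes g :: "'a::real_normed_vector \<Rightarrow> real" and u v x :: 'a
  defines "p \<equiv> \<lambda>y. frechet_derivative g (at y) u"
  assumes V: "open V" "x \<in> V" and g: "\<And>y. y \<in> V \<Longrightarrow> g differentiable (at y)"
    and p: "p differentiable (at x)"
  shows "((\<lambda>t. (g (x + t *\<^sub>R u + t *\<^sub>R v) - g (x + t *\<^sub>R u) - g (x + t *\<^sub>R v) + g x) / t\<^sup>2)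
    \<longlongrightarrow> frechet_derivative p (at x) v) (at_right 0)"
proof (rule tendstoI)
  txt \<open>
    The mean value theorem in the direction \<open>u\<close> leaves a first difference of \<open>p\<close>, to which only
    differentiability at the single point \<open>x\<close> is applied.
  \<close>
  fix e :: real assume "e > 0"
  define P where "P = frechet_derivative p (at x)"
  define N where "N = norm u + norm v + 1"
  have N: "N > 0" "norm u \<le> N" "norm v \<le> N" "norm u + norm v < N"
    by (auto simp: N_def add_nonneg_pos)
  have P: "(p has_derivative P) (at x)"
    using p P_def frechet_derivative_works by blast
  then have linP: "linear P"
    by (rule has_derivative_linear)
  \<comment> \<open>Two estimates \<open>pb\<close> are subtracted below, each with error
    \<open>e' * (t * N)\<close>, that is t e / 4; the sum t e / 2 stays strictly below t e.\<close>
  define e' where "e' = e / (4 * N)"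
  have "e' > 0" using \<open>e > 0\<close> N by (simp add: e'_def)
  obtain d where d: "d > 0" "\<And>y. norm (y - x) < d \<Longrightarrow> norm (p y - p x - P (y - x)) \<le> e' * norm (y - x)"
    using P \<open>e' > 0\<close> unfolding has_derivative_at_alt by blast
  obtain r where r: "r > 0" "ball x r \<subseteq> V"
    using V open_contains_ball by blast
  define \<delta> where "\<delta> = min d r / N"
  have \<delta>: "\<delta> > 0" using d r N by (simp add: \<delta>_def)
  have "dist ((g (x + t *\<^sub>R u + t *\<^sub>R v) - g (x + t *\<^sub>R u) - g (x + t *\<^sub>R v) + g x) / t\<^sup>2) (P v) < e"
    if t: "0 < t" "t < \<delta>" for t
  proof -
    have tN: "t * N < min d r"
      using t N by (simp add: \<delta>_def field_simps)
    have small: "norm (s *\<^sub>R u + s' *\<^sub>R v) \<le> t * N" if "0 \<le> s" "s \<le> t" "0 \<le> s'" "s' \<le> t" for s s'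
    proof -
      have "norm (s *\<^sub>R u + s' *\<^sub>R v) \<le> s * norm u + s' * norm v"
        using norm_triangle_ineq[of "s *\<^sub>R u" "s' *\<^sub>R v"] that by simp
      also have "\<dots> \<le> t * norm u + t * norm v"
        using that by (intro add_mono mult_right_mono) auto
      also have "\<dots> = t * (norm u + norm v)" by (simp add: algebra_simps)
      also have "\<dots> \<le> t * N" using t N by (intro mult_left_mono) auto
      finally show ?thesis .
    qed
    have inV: "x + s *\<^sub>R u + s' *\<^sub>R v \<in> V" if "0 \<le> s" "s \<le> t" "0 \<le> s'" "s' \<le> t" for s s'
    proof -
      have "dist (x + (s *\<^sub>R u + s' *\<^sub>R v)) x < r"
        using small[OF that] tN by (simp add: dist_norm)
      then have "x + (s *\<^sub>R u + s' *\<^sub>R v) \<in> V"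
        using r(2) by (metis dist_commute mem_ball subsetD)
      then show ?thesis by (simp only: add.assoc)
    qed
    have pb: "\<bar>p (x + s *\<^sub>R u + s' *\<^sub>R v) - p x - (s * P u + s' * P v)\<bar> \<le> e' * (t * N)"
      if "0 \<le> s" "s \<le> t" "0 \<le> s'" "s' \<le> t" for s s'
    proof -
      have "norm (p (x + (s *\<^sub>R u + s' *\<^sub>R v)) - p x - P (x + (s *\<^sub>R u + s' *\<^sub>R v) - x))
        \<le> e' * norm (x + (s *\<^sub>R u + s' *\<^sub>R v) - x)"
        using small[OF that] tN by (intro d) simp
      also have "\<dots> \<le> e' * (t * N)"
        using small[OF that] \<open>e' > 0\<close> by (intro mult_left_mono) auto
      finally show ?thesis
        using linP by (simp add: linear_add linear_scale add.assoc)
    qed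
    have der: "((\<lambda>s. g (x + s *\<^sub>R u + s' *\<^sub>R v)) has_real_derivative p (x + s *\<^sub>R u + s' *\<^sub>R v)) (at s)"
      if "0 \<le> s" "s \<le> t" "0 \<le> s'" "s' \<le> t" for s s'
    proof -
      have *: "(g has_derivative frechet_derivative g (at (x + s *\<^sub>R u + s' *\<^sub>R v)))
        (at (x + s *\<^sub>R u + s' *\<^sub>R v))"
        using g[OF inV[OF that]] frechet_derivative_works by blast
      have "((\<lambda>s. x + s *\<^sub>R u + s' *\<^sub>R v) has_derivative (\<lambda>h. h *\<^sub>R u)) (at s)"
        by (auto intro!: derivative_eq_intros)
      from has_derivative_compose[OF this *] have "((\<lambda>s. g (x + s *\<^sub>R u + s' *\<^sub>R v)) has_derivative
        (\<lambda>h. frechet_derivative g (at (x + s *\<^sub>R u + s' *\<^sub>R v)) (h *\<^sub>R u))) (at s)" .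
      moreover have "frechet_derivative g (at (x + s *\<^sub>R u + s' *\<^sub>R v)) (h *\<^sub>R u) = p (x + s *\<^sub>R u + s' *\<^sub>R v) * h" for h
        using linear_frechet_derivative[OF g[OF inV[OF that]]] by (simp add: linear_scale p_def)
      ultimately show ?thesis
        by (simp add: has_field_derivative_def)
    qed
    \<comment> \<open>The function is s \<mapsto> g(x + s u + t v) - g(x + s u) on [0, t]. The
      summands with factor 0 are kept so that \<open>der\<close> covers both terms, with
      \<open>s'\<close> equal to t and to 0.\<close>
    have "\<exists>z. 0 < z \<and> z < t \<and> (g (x + t *\<^sub>R u + t *\<^sub>R v) - g (x + t *\<^sub>R u + 0 *\<^sub>R v))
        - (g (x + 0 *\<^sub>R u + t *\<^sub>R v) - g (x + 0 *\<^sub>R u + 0 *\<^sub>R v))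
      = (t - 0) * (p (x + z *\<^sub>R u + t *\<^sub>R v) - p (x + z *\<^sub>R u + 0 *\<^sub>R v))"
      using t by (intro MVT2) (auto intro!: DERIV_diff der simp del: scaleR_zero_left)
    then obtain z where z: "0 < z" "z < t" and
      \<Delta>: "g (x + t *\<^sub>R u + t *\<^sub>R v) - g (x + t *\<^sub>R u) - g (x + t *\<^sub>R v) + g x
        = t * (p (x + z *\<^sub>R u + t *\<^sub>R v) - p (x + z *\<^sub>R u + 0 *\<^sub>R v))"
      by auto
    have "\<bar>(p (x + z *\<^sub>R u + t *\<^sub>R v) - p (x + z *\<^sub>R u + 0 *\<^sub>R v)) - t * P v\<bar> \<le> 2 * (e' * (t * N))"
      using pb[of z t] pb[of z 0] z t by linarith
    also have "\<dots> < t * e"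
      using t \<open>e > 0\<close> N by (simp add: e'_def)
    finally have *: "\<bar>(p (x + z *\<^sub>R u + t *\<^sub>R v) - p (x + z *\<^sub>R u + 0 *\<^sub>R v)) - t * P v\<bar> < t * e" .
    have "t * q / t\<^sup>2 - P v = (q - t * P v) / t" for q
      using t by (simp add: field_simps power2_eq_square)
    then show ?thesis
      unfolding \<Delta> dist_real_def using * t by (simp only:) (simp add: abs_divide pos_divide_less_eq mult.commute)
  qed
  then show "\<forall>\<^sub>F t in at_right 0. dist ((g (x + t *\<^sub>R u + t *\<^sub>R v) - g (x + t *\<^sub>R u) - g (x + t *\<^sub>R v) + g x) / t\<^sup>2)
      (frechet_derivative p (at x) v) < e"
    unfolding P_def by (intro eventually_mono[OF eventually_at_right_real[OF \<delta>]]) simp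
qed

text \<open>The second difference is symmetric in u and v, so one and the same quotient tends to
  both mixed derivatives.\<close>

lemma mixed_derivatives_commute_real:
  fixes g :: "'a::real_normed_vector \<Rightarrow> real"
  assumes V: "open V" "x \<in> V" and g: "\<And>y. y \<in> V \<Longrightarrow> g differentiable (at y)"
    and u: "(\<lambda>y. frechet_derivative g (at y) u) differentiable (at x)"
    and v: "(\<lambda>y. frechet_derivative g (at y) v) differentiable (at x)"
  shows "frechet_derivative (\<lambda>y. frechet_derivative g (at y) u) (at x) v =
    frechet_derivative (\<lambda>y. frechet_derivative g (at y) v) (at x) u"
proof -
  let ?d = "\<lambda>t. (g (x + t *\<^sub>R u + t *\<^sub>R v) - g (x + t *\<^sub>R u) - g (x + t *\<^sub>R v) + g x) / t\<^sup>2"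
  have "(\<lambda>t. (g (x + t *\<^sub>R v + t *\<^sub>R u) - g (x + t *\<^sub>R v) - g (x + t *\<^sub>R u) + g x) / t\<^sup>2) = ?d"
    by (rule ext) (simp add: add.commute add.left_commute)
  then have "(?d \<longlongrightarrow> frechet_derivative (\<lambda>y. frechet_derivative g (at y) v) (at x) u) (at_right 0)"
    using second_difference_tendsto[OF V g v, of u] by simp
  with second_difference_tendsto[OF V g u, of v] show ?thesis
    by (rule tendsto_unique[OF trivial_limit_at_right_real])
qed

lemma frechet_derivative_inner:
  assumes "g differentiable (at x)"
  shows "frechet_derivative (\<lambda>y. g y \<bullet> b) (at x) u = frechet_derivative g (at x) u \<bullet> b"
proof -
  have "(g has_derivative frechet_derivative g (at x)) (at x)"
    using assms frechet_derivative_works by blast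
  then have "((\<lambda>y. g y \<bullet> b) has_derivative (\<lambda>u. frechet_derivative g (at x) u \<bullet> b)) (at x)"
    by (rule has_derivative_inner_left)
  from frechet_derivative_at[OF this] show ?thesis by metis
qed

text \<open>\<open>frechet_derivative\<close> chooses among all derivatives at the point, and
  functions that agree near x have the same ones.\<close>

lemma frechet_derivative_cong_open:
  assumes "open V" "x \<in> V" "\<And>y. y \<in> V \<Longrightarrow> f y = g y"
  shows "frechet_derivative f (at x) = frechet_derivative g (at x)"
proof -
  have "(f has_derivative D) (at x) \<longleftrightarrow> (g has_derivative D) (at x)" for D
    using has_derivative_transform_within_open[of f D x UNIV V g]
      has_derivative_transform_within_open[of g D x UNIV V f] assms by auto
  then show ?thesis
    unfolding frechet_derivative_def by simp
qed

lemma differentiable_cong_open: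
  assumes "open V" "x \<in> V" "\<And>y. y \<in> V \<Longrightarrow> f y = g y" "g differentiable (at x)"
  shows "f differentiable (at x)"
proof -
  obtain D where "(g has_derivative D) (at x)"
    using assms(4) unfolding differentiable_def by blast
  then have "(f has_derivative D) (at x)"
    by (rule has_derivative_transform_within_open) (use assms in auto)
  then show ?thesis by (rule differentiableI)
qed

lemma mixed_derivatives_commute:
  fixes g :: "'a::real_normed_vector \<Rightarrow> 'b::euclidean_space"
  assumes V: "open V" "x \<in> V" and g: "\<And>y. y \<in> V \<Longrightarrow> g differentiable (at y)"
    and u: "(\<lambda>y. frechet_derivative g (at y) u) differentiable (at x)"
    and v: "(\<lambda>y. frechet_derivative g (at y) v) differentiable (at x)"
  shows "frechet_derivative (\<lambda>y. frechet_derivative g (at y) u) (at x) v =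
    frechet_derivative (\<lambda>y. frechet_derivative g (at y) v) (at x) u"
proof (rule euclidean_eqI)
  fix b :: 'b
  let ?g = "\<lambda>y. g y \<bullet> b"
  have 1: "frechet_derivative ?g (at y) w = frechet_derivative g (at y) w \<bullet> b" if "y \<in> V" for y w
    using that g by (intro frechet_derivative_inner)
  have dg: "?g differentiable (at y)" if "y \<in> V" for y
    using g[OF that] by (intro differentiable_inner) auto
  have 2: "(\<lambda>y. frechet_derivative ?g (at y) w) differentiable (at x)" 
       "frechet_derivative (\<lambda>y. frechet_derivative ?g (at y) w) (at x) z
       = frechet_derivative (\<lambda>y. frechet_derivative g (at y) w) (at x) z \<bullet> b"
    if w: "(\<lambda>y. frechet_derivative g (at y) w) differentiable (at x)" for w z
  proof -
    show "(\<lambda>y. frechet_derivative ?g (at y) w) differentiable (at x)"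
      by (rule differentiable_cong_open[OF V 1]) (use w in auto)
    show "frechet_derivative (\<lambda>y. frechet_derivative ?g (at y) w) (at x) z
       = frechet_derivative (\<lambda>y. frechet_derivative g (at y) w) (at x) z \<bullet> b"
      using frechet_derivative_cong_open[OF V 1] frechet_derivative_inner[OF w] by simp
  qed
  show "frechet_derivative (\<lambda>y. frechet_derivative g (at y) u) (at x) v \<bullet> b =
    frechet_derivative (\<lambda>y. frechet_derivative g (at y) v) (at x) u \<bullet> b"
    using mixed_derivatives_commute_real[OF V dg 2(1)[OF u] 2(1)[OF v]] 2(2)[OF u] 2(2)[OF v] by simp
qed

section \<open>Consequences of smoothness, Cramer's rule and a product rule\<close>

lemma smooth_on_differentiable: "smooth_on V f \<Longrightarrow> x \<in> V \<Longrightarrow> f differentiable (at x)"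
  by (metis Ck_on.simps(2) smooth_on_def)

lemma smooth_on_frechet_derivative: "smooth_on V f \<Longrightarrow> smooth_on V (\<lambda>x. frechet_derivative f (at x) v)"
  by (metis Ck_on.simps(2) smooth_on_def)

lemma smooth_on_const: "smooth_on V (\<lambda>_. c)"
proof -
  have "Ck_on k V (\<lambda>_. c)" for k
    by (induction k arbitrary: c) auto
  then show ?thesis by (simp add: smooth_on_def)
qed

lemma differentiable_prod:
  fixes f :: "'i \<Rightarrow> 'a::real_normed_vector \<Rightarrow> real"
  assumes "\<And>i. i \<in> I \<Longrightarrow> f i differentiable (at x)"
  shows "(\<lambda>y. \<Prod>i\<in>I. f i y) differentiable (at x)"
  using assms by (induction I rule: infinite_finite_induct) (auto intro!: differentiable_mult)

lemma differentiable_det: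
  fixes A :: "'a::real_normed_vector \<Rightarrow> real^'n^'n"
  assumes "\<And>i j. (\<lambda>y. A y $ i $ j) differentiable (at x)"
  shows "(\<lambda>y. det (A y)) differentiable (at x)"
  unfolding det_def by (intro differentiable_sum differentiable_mult differentiable_prod assms) (auto intro!: assms finite_permutations differentiable_prod)

lemma differentiable_cart:
  fixes f :: "'a::real_normed_vector \<Rightarrow> real^'n"
  shows "f differentiable (at x) \<longleftrightarrow> (\<forall>i. (\<lambda>y. f y $ i) differentiable (at x))"
  unfolding differentiable_componentwise_within[of f] Basis_vec_def
  by (auto simp: inner_axis)

text \<open>Cramer's rule writes each coordinate of z as a quotient of determinants whose entries
  are differentiable at x. This is how quantities known only through a linear equation become
  differentiable.\<close>

lemma differentiable_solution:
  fixes \<Phi> :: "'a::real_normed_vector \<Rightarrow> real^'n \<Rightarrow> real^'n"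
  assumes V: "open V" "x \<in> V"
    and \<Phi>: "\<And>y. y \<in> V \<Longrightarrow> linear (\<Phi> y)" "\<And>y. y \<in> V \<Longrightarrow> inj (\<Phi> y)"
      "\<And>c. (\<lambda>y. \<Phi> y c) differentiable (at x)"
    and b: "b differentiable (at x)" and z: "\<And>y. y \<in> V \<Longrightarrow> \<Phi> y (z y) = b y"
  shows "z differentiable (at x)"
proof -
  let ?A = "\<lambda>y. matrix (\<Phi> y)"
  have det: "det (?A y) \<noteq> 0" if "y \<in> V" for y
    using \<Phi>(1,2)[OF that] det_nz_iff_inj by blast
  have sol: "z y = (\<chi> k. det (\<chi> i j. if j = k then b y $ i else ?A y $ i $ j) / det (?A y))" if "y \<in> V" for y
    using cramer[OF det[OF that], of "z y" "b y"] fun_cong[OF matrix_vector_mul(2)[OF \<Phi>(1)[OF that]], of "z y"] z[OF that] by simp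
  have A: "(\<lambda>y. ?A y $ i $ j) differentiable (at x)" for i j
    using \<Phi>(3)[of "axis j 1"] by (simp add: differentiable_cart matrix_def)
  have b': "(\<lambda>y. b y $ i) differentiable (at x)" for i
    using b by (simp add: differentiable_cart)
  have entry: "(\<lambda>y. (\<chi> i j. if j = k then b y $ i else ?A y $ i $ j) $ i $ j) differentiable (at x)" for i j k
    using A b' by (cases "j = k") simp_all
  have "(\<lambda>y. (\<chi> k. det (\<chi> i j. if j = k then b y $ i else ?A y $ i $ j) / det (?A y))) differentiable (at x)"
    unfolding differentiable_cart
  proof
    fix k
    have "(\<lambda>y. det (\<chi> i j. if j = k then b y $ i else ?A y $ i $ j) / det (?A y)) differentiable (at x)"
      using det[OF V(2)] A entry by (intro differentiable_divide differentiable_det) auto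
    then show "(\<lambda>y. (\<chi> k. det (\<chi> i j. if j = k then b y $ i else ?A y $ i $ j) / det (?A y)) $ k) differentiable (at x)"
      by simp
  qed
  from differentiable_cong_open[OF V _ this] show ?thesis
    using sol by blast
qed

text \<open>A product rule when the dependence of \<open>B\<close> on the point is known only on
  fixed vectors: expanding the argument in the standard basis leaves finitely many scalar
  products.\<close>

lemma frechet_derivative_bilinear_apply:
  fixes B :: "'a::real_normed_vector \<Rightarrow> real^'n \<Rightarrow> 'b::real_normed_vector"
  assumes V: "open V" "x \<in> V" and lin: "\<And>y. y \<in> V \<Longrightarrow> linear (B y)"
    and B: "\<And>c. (\<lambda>y. B y c) differentiable (at x)" and Y: "Y differentiable (at x)"
  shows "(\<lambda>y. B y (Y y)) differentiable (at x)"
    and "frechet_derivative (\<lambda>y. B y (Y y)) (at x) u =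
      frechet_derivative (\<lambda>y. B y (Y x)) (at x) u + B x (frechet_derivative Y (at x) u)"
proof -
  have expand: "B y c = (\<Sum>i\<in>UNIV. (c $ i) *\<^sub>R B y (axis i 1))" if "y \<in> V" for y c
  proof -
    have "B y c = B y (\<Sum>i\<in>UNIV. (c $ i) *\<^sub>R axis i 1)"
      using basis_expansion[of c] by (simp add: scalar_mult_eq_scaleR)
    then show ?thesis
      using lin[OF that] by (simp add: linear_sum linear_scale o_def)
  qed
  define dB where "dB i = frechet_derivative (\<lambda>y. B y (axis i 1)) (at x)" for i
  define dY where "dY = frechet_derivative Y (at x)"
  have dB: "((\<lambda>y. B y (axis i 1)) has_derivative dB i) (at x)" for i
    using B[of "axis i 1"] unfolding dB_def frechet_derivative_works .
  have dY: "((\<lambda>y. Y y $ i) has_derivative (\<lambda>u. dY u $ i)) (at x)" for i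
    using Y unfolding dY_def frechet_derivative_works
    by (rule bounded_linear.has_derivative[OF bounded_linear_vec_nth])
  have "((\<lambda>y. \<Sum>i\<in>UNIV. (Y y $ i) *\<^sub>R B y (axis i 1)) has_derivative
     (\<lambda>u. \<Sum>i\<in>UNIV. (Y x $ i) *\<^sub>R dB i u + (dY u $ i) *\<^sub>R B x (axis i 1))) (at x)"
    by (intro has_derivative_sum has_derivative_scaleR dY dB)
  then have 1: "((\<lambda>y. B y (Y y)) has_derivative
     (\<lambda>u. \<Sum>i\<in>UNIV. (Y x $ i) *\<^sub>R dB i u + (dY u $ i) *\<^sub>R B x (axis i 1))) (at x)"
    by (rule has_derivative_transform_within_open[OF _ V]) (rule expand[symmetric])
  then show "(\<lambda>y. B y (Y y)) differentiable (at x)"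
    by (rule differentiableI)
  have "((\<lambda>y. \<Sum>i\<in>UNIV. (Y x $ i) *\<^sub>R B y (axis i 1)) has_derivative
     (\<lambda>u. \<Sum>i\<in>UNIV. (Y x $ i) *\<^sub>R dB i u)) (at x)"
    by (intro has_derivative_sum has_derivative_scaleR_right dB)
  then have 2: "((\<lambda>y. B y (Y x)) has_derivative (\<lambda>u. \<Sum>i\<in>UNIV. (Y x $ i) *\<^sub>R dB i u)) (at x)"
    by (rule has_derivative_transform_within_open[OF _ V]) (rule expand[symmetric])
  show "frechet_derivative (\<lambda>y. B y (Y y)) (at x) u =
      frechet_derivative (\<lambda>y. B y (Y x)) (at x) u + B x (frechet_derivative Y (at x) u)"
    using expand[OF V(2), of "dY u"]
    by (simp add: frechet_derivative_at[OF 1, symmetric] frechet_derivative_at[OF 2, symmetric]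
        sum.distrib dY_def)
qed

section \<open>Gauss and Codazzi equations\<close>

locale hypersurface_chart =
  fixes V :: "(real^3) set" and f \<xi> :: "real^3 \<Rightarrow> real^4"
  assumes open_V: "open V"
    and smooth_f: "smooth_on V f" and smooth_\<xi>: "smooth_on V \<xi>"
    and transversal: "transversal_immersion V f \<xi>"
    and equiaffine: "x \<in> V \<Longrightarrow> range (frechet_derivative \<xi> (at x)) \<subseteq> range (frechet_derivative f (at x))"
begin

abbreviation df :: "real^3 \<Rightarrow> real^3 \<Rightarrow> real^4"
  where "df x \<equiv> frechet_derivative f (at x)"

abbreviation d2f :: "real^3 \<Rightarrow> real^3 \<Rightarrow> real^3 \<Rightarrow> real^4"
  where "d2f x u v \<equiv> frechet_derivative (\<lambda>y. df y v) (at x) u"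

abbreviation h :: "real^3 \<Rightarrow> real^3 \<Rightarrow> real^3 \<Rightarrow> real"
  where "h \<equiv> affine_metric f \<xi>"

abbreviation S :: "real^3 \<Rightarrow> real^3 \<Rightarrow> real^3"
  where "S \<equiv> shape_operator f \<xi>"

text \<open>
  All tensorial arguments are extended by fields that are constant in the chart, so \<open>\<Gamma>\<close> holds the
  Christoffel symbols.
\<close>

definition \<Gamma> :: "real^3 \<Rightarrow> real^3 \<Rightarrow> real^3 \<Rightarrow> real^3"
  where "\<Gamma> x u v = induced_connection f \<xi> (\<lambda>_. u) (\<lambda>_. v) x"

lemma linear_df: "x \<in> V \<Longrightarrow> linear (df x)"
  using smooth_on_differentiable[OF smooth_f] linear_frechet_derivative by blast

lemma differentiable_df: "x \<in> V \<Longrightarrow> (\<lambda>y. df y v) differentiable (at x)"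
  using smooth_on_differentiable smooth_on_frechet_derivative smooth_f by blast

lemma differentiable_d2f: "x \<in> V \<Longrightarrow> (\<lambda>y. d2f y u v) differentiable (at x)"
  using smooth_on_differentiable smooth_on_frechet_derivative smooth_f by blast

lemma differentiable_\<xi>: "x \<in> V \<Longrightarrow> \<xi> differentiable (at x)"
  using smooth_on_differentiable smooth_\<xi> by blast

text \<open>This is what transversality means for computations: an equation in \<open>real^4\<close>
  splits into a tangential and a transversal one. It also makes the definite descriptions in the
  definitions meaningful.\<close>

lemma frame_inject:
  assumes x: "x \<in> V" and eq: "df x t + a *\<^sub>R \<xi> x = df x t' + a' *\<^sub>R \<xi> x"
  shows "t = t' \<and> a = a'"
proof -
  have inj: "inj (df x)" and nr: "\<xi> x \<notin> range (df x)"
    using transversal x unfolding transversal_immersion_def by auto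
  have lin: "linear (df x)" by (rule linear_df[OF x])
  have *: "(a - a') *\<^sub>R \<xi> x = df x (t' - t)"
    using eq lin by (simp add: linear_diff algebra_simps)
  have "a = a'"
  proof (rule ccontr)
    assume "a \<noteq> a'"
    then have "\<xi> x = df x ((1 / (a - a')) *\<^sub>R (t' - t))"
      using lin by (simp add: linear_scale *[symmetric])
    with nr show False by blast
  qed
  moreover from this have "df x t = df x t'" using eq by simp
  ultimately show ?thesis using inj by (simp add: inj_eq)
qed

text \<open>
  A vector of \<open>real^4\<close> encodes a pair of a tangent vector and a transversal component, so that the
  decomposition along the frame becomes a square linear system.
\<close>

definition tan3 :: "real^4 \<Rightarrow> real^3"
  where "tan3 z = vector [z $ 1, z $ 2, z $ 3]"

definition frame :: "real^3 \<Rightarrow> real^4 \<Rightarrow> real^4"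
  where "frame x z = df x (tan3 z) + (z $ 4) *\<^sub>R \<xi> x"

lemma linear_tan3: "linear tan3"
  by (rule linearI) (simp_all add: tan3_def vec_eq_iff forall_3)

lemma tan3_surj: "\<exists>z. tan3 z = t \<and> z $ 4 = a"
  by (rule exI[of _ "\<chi> i. if i = 1 then t $ 1 else if i = 2 then t $ 2 else if i = 3 then t $ 3 else a"]) (simp add: tan3_def vec_eq_iff forall_3)

lemma linear_frame: "x \<in> V \<Longrightarrow> linear (frame x)"
  using linear_df linear_tan3 by (intro linearI) (simp_all add: frame_def linear_add linear_scale algebra_simps)

lemma inj_frame:
  assumes "x \<in> V" shows "inj (frame x)"
proof (rule injI)
  fix z z' assume "frame x z = frame x z'"
  then have "tan3 z = tan3 z' \<and> z $ 4 = z' $ 4"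
    using frame_inject[OF assms] unfolding frame_def by blast
  then show "z = z'"
    by (simp add: tan3_def vec_eq_iff forall_3 forall_4)
qed

lemma differentiable_frame: "x \<in> V \<Longrightarrow> (\<lambda>y. frame y z) differentiable (at x)"
  unfolding frame_def using differentiable_df differentiable_\<xi> by simp

lemma frame_ex:
  assumes "x \<in> V" shows "\<exists>t a. w = df x t + a *\<^sub>R \<xi> x"
proof -
  have "surj (frame x)"
    using linear_frame inj_frame assms linear_injective_imp_surjective by blast
  then obtain z where "w = frame x z" by blast
  then show ?thesis unfolding frame_def by blast
qed

lemma tangential_part_eq:
  assumes "x \<in> V" "w = df x t + a *\<^sub>R \<xi> x"
  shows "tangential_part f \<xi> x w = t" "transversal_part f \<xi> x w = a"
  unfolding tangential_part_def transversal_part_def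
  by (rule the_equality; use assms frame_inject[OF assms(1)] in blast)+

lemma frame_decomposition:
  assumes "x \<in> V"
  shows "w = df x (tangential_part f \<xi> x w) + transversal_part f \<xi> x w *\<^sub>R \<xi> x"
  using frame_ex[OF assms, of w] tangential_part_eq[OF assms] by metis

lemma gauss_formula: "x \<in> V \<Longrightarrow> d2f x u v = df x (\<Gamma> x u v) + h x u v *\<^sub>R \<xi> x"
  unfolding \<Gamma>_def induced_connection_def affine_metric_def flat_deriv_def
  by (rule frame_decomposition)

text \<open>By uniqueness of the decomposition, symmetry and linearity of \<open>d2f\<close> are
  inherited by \<Gamma> and \<open>h\<close> simultaneously.\<close>

lemma gauss_formulaI:
  assumes "x \<in> V" "d2f x u v = df x t + a *\<^sub>R \<xi> x"
  shows "\<Gamma> x u v = t" "h x u v = a"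
proof -
  have "df x (\<Gamma> x u v) + h x u v *\<^sub>R \<xi> x = df x t + a *\<^sub>R \<xi> x"
    using assms(2) gauss_formula[OF assms(1), where u = u and v = v] by (rule trans[OF sym, rotated])
  from frame_inject[OF assms(1) this] show "\<Gamma> x u v = t" "h x u v = a"
    by auto
qed

lemma weingarten_formula: "x \<in> V \<Longrightarrow> frechet_derivative \<xi> (at x) u = - df x (S x u)"
proof -
  assume x: "x \<in> V"
  obtain t where t: "frechet_derivative \<xi> (at x) u = df x t"
    using equiaffine[OF x] by blast
  then have "tangential_part f \<xi> x (frechet_derivative \<xi> (at x) u) = t"
    using tangential_part_eq(1)[OF x, of "df x t" t 0] by simp
  then show ?thesis
    using t linear_df[OF x] by (simp add: shape_operator_def linear_neg)
qed

text \<open>The Gauss formula is a linear system with matrix \<open>frame y\<close>, right-hand side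
  \<open>d2f y u v\<close> and solution \<open>z y\<close>, the coordinates of \<Gamma> and
  \<open>h\<close>; Cramer's rule applies.\<close>

lemma differentiable_\<Gamma>_h:
  assumes x: "x \<in> V"
  shows "(\<lambda>y. \<Gamma> y u v) differentiable (at x)" "(\<lambda>y. h y u v) differentiable (at x)"
proof -
  define z where "z y = (SOME z. tan3 z = \<Gamma> y u v \<and> z $ 4 = h y u v)" for y
  have z: "tan3 (z y) = \<Gamma> y u v" "z y $ 4 = h y u v" for y
    using someI_ex[OF tan3_surj[of "\<Gamma> y u v" "h y u v"]] unfolding z_def by auto
  have "z differentiable (at x)"
  proof (rule differentiable_solution[OF open_V x])
    show "frame y (z y) = d2f y u v" if "y \<in> V" for y
      using gauss_formula[OF that] by (simp add: frame_def z)
  qed (use linear_frame inj_frame differentiable_frame[OF x] differentiable_d2f[OF x] in auto)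
  then have zi: "(\<lambda>y. z y $ i) differentiable (at x)" for i
    by (simp add: differentiable_cart)
  then show "(\<lambda>y. h y u v) differentiable (at x)"
    using zi[of 4] by (simp add: z)
  have "(\<lambda>y. tan3 (z y)) differentiable (at x)"
    using zi by (simp add: differentiable_cart tan3_def forall_3)
  then show "(\<lambda>y. \<Gamma> y u v) differentiable (at x)"
    by (simp add: z)
qed

section \<open>Structure equations from the symmetry of higher derivatives\<close>

lemma d2f_commute: "x \<in> V \<Longrightarrow> d2f x u v = d2f x v u"
  by (rule mixed_derivatives_commute[OF open_V]) (use smooth_on_differentiable[OF smooth_f] differentiable_df in auto)

text \<open>Both parts are the symmetry of the second derivative of \<open>f\<close>; the tangential
  one says that the induced connection is torsion-free.\<close>

lemma \<Gamma>_h_commute: "x \<in> V \<Longrightarrow> \<Gamma> x u v = \<Gamma> x v u" "x \<in> V \<Longrightarrow> h x u v = h x v u"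
  using gauss_formulaI[where x = x and u = u and v = v,
      OF _ trans[OF d2f_commute gauss_formula[where u = v and v = u]]] by auto

lemma linear_d2f:
  assumes "x \<in> V" shows "linear (\<lambda>u. d2f x u v)"
  by (rule linear_frechet_derivative[OF differentiable_df[OF assms]])

text \<open>The first argument is the direction of differentiation, where linearity of the
  derivative applies; the second argument then follows by symmetry.\<close>

lemma linear_\<Gamma>_h1:
  assumes x: "x \<in> V"
  shows "linear (\<lambda>u. \<Gamma> x u v)" "linear (\<lambda>u. h x u v)"
proof -
  have lin: "linear (df x)" by (rule linear_df[OF x])
  have add: "d2f x (u + u') v = df x (\<Gamma> x u v + \<Gamma> x u' v) + (h x u v + h x u' v) *\<^sub>R \<xi> x" for u u'
  proof -
    have "d2f x (u + u') v = d2f x u v + d2f x u' v"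
      by (rule linear_add[OF linear_d2f[OF x]])
    then show ?thesis
      unfolding gauss_formula[OF x, where u = u] gauss_formula[OF x, where u = u']
      by (simp add: linear_add[OF lin] algebra_simps)
  qed
  have scale: "d2f x (c *\<^sub>R u) v = df x (c *\<^sub>R \<Gamma> x u v) + (c * h x u v) *\<^sub>R \<xi> x" for u c
  proof -
    have "d2f x (c *\<^sub>R u) v = c *\<^sub>R d2f x u v"
      by (rule linear_scale[OF linear_d2f[OF x]])
    then show ?thesis
      unfolding gauss_formula[OF x, where u = u]
      by (simp add: linear_scale[OF lin] algebra_simps)
  qed
  show "linear (\<lambda>u. \<Gamma> x u v)"
    by (rule linearI) (rule gauss_formulaI(1)[OF x add], rule gauss_formulaI(1)[OF x scale])
  show "linear (\<lambda>u. h x u v)"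
    by (rule linearI) (rule gauss_formulaI(2)[OF x add], simp only: gauss_formulaI(2)[OF x scale] real_scaleR_def)
qed

lemma linear_\<Gamma>_h2:
  assumes x: "x \<in> V"
  shows "linear (\<lambda>v. \<Gamma> x u v)" "linear (\<lambda>v. h x u v)"
  using linear_\<Gamma>_h1[OF x, of u] by (simp_all add: \<Gamma>_h_commute[OF x, of u])

text \<open>Differentiate the Gauss formula by the product rule, then decompose the new derivatives
  of \<open>df\<close> and \<xi> by the Gauss and Weingarten formulas.\<close>

lemma third_derivative:
  assumes x: "x \<in> V"
  shows "frechet_derivative (\<lambda>y. d2f y u v) (at x) w =
    df x (\<Gamma> x w (\<Gamma> x u v) + frechet_derivative (\<lambda>y. \<Gamma> y u v) (at x) w - h x u v *\<^sub>R S x w)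
    + (h x w (\<Gamma> x u v) + frechet_derivative (\<lambda>y. h y u v) (at x) w) *\<^sub>R \<xi> x"
proof -
  let ?g1 = "\<lambda>y. df y (\<Gamma> y u v)" and ?g2 = "\<lambda>y. h y u v *\<^sub>R \<xi> y"
  note lin = linear_df[OF x]
  have 1: "?g1 differentiable (at x)" "frechet_derivative ?g1 (at x) w =
      d2f x w (\<Gamma> x u v) + df x (frechet_derivative (\<lambda>y. \<Gamma> y u v) (at x) w)"
    using frechet_derivative_bilinear_apply[of V x df, OF open_V x linear_df differentiable_df[OF x] differentiable_\<Gamma>_h(1)[OF x]]
    by auto
  have h: "((\<lambda>y. h y u v) has_derivative frechet_derivative (\<lambda>y. h y u v) (at x)) (at x)"
    using differentiable_\<Gamma>_h(2)[OF x] unfolding frechet_derivative_works .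
  have \<xi>: "(\<xi> has_derivative frechet_derivative \<xi> (at x)) (at x)"
    using differentiable_\<xi>[OF x] unfolding frechet_derivative_works .
  have g1: "(?g1 has_derivative frechet_derivative ?g1 (at x)) (at x)"
    using 1(1) unfolding frechet_derivative_works .
  have "((\<lambda>y. ?g1 y + ?g2 y) has_derivative (\<lambda>w. frechet_derivative ?g1 (at x) w +
     (h x u v *\<^sub>R frechet_derivative \<xi> (at x) w + frechet_derivative (\<lambda>y. h y u v) (at x) w *\<^sub>R \<xi> x))) (at x)"
    by (intro has_derivative_add has_derivative_scaleR h \<xi> g1)
  from fun_cong[OF frechet_derivative_at[OF this, symmetric]]
  have "frechet_derivative (\<lambda>y. ?g1 y + ?g2 y) (at x) w = frechet_derivative ?g1 (at x) w +
     (h x u v *\<^sub>R frechet_derivative \<xi> (at x) w + frechet_derivative (\<lambda>y. h y u v) (at x) w *\<^sub>R \<xi> x)" .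
  moreover have "frechet_derivative (\<lambda>y. d2f y u v) (at x) = frechet_derivative (\<lambda>y. ?g1 y + ?g2 y) (at x)"
    by (rule frechet_derivative_cong_open[OF open_V x gauss_formula])
  ultimately show ?thesis
    unfolding 1(2) weingarten_formula[OF x] gauss_formula[OF x, where u = w and v = "\<Gamma> x u v"]
    by (simp add: linear_add[OF lin] linear_diff[OF lin] linear_scale[OF lin] algebra_simps)
qed

text \<open>This is the flatness of the ambient connection, applied to the map y \<mapsto>
  \<open>df y v\<close>.\<close>

lemma third_derivative_commute:
  "x \<in> V \<Longrightarrow> frechet_derivative (\<lambda>y. d2f y u v) (at x) w = frechet_derivative (\<lambda>y. d2f y w v) (at x) u"
  by (rule mixed_derivatives_commute[OF open_V]) (use differentiable_df differentiable_d2f in auto)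

text \<open>The two components of the commuting third derivatives. The fields being constant, no
  bracket term appears.\<close>

lemma gauss_codazzi:
  assumes "x \<in> V"
  shows gauss_equation: "\<Gamma> x w (\<Gamma> x u v) + frechet_derivative (\<lambda>y. \<Gamma> y u v) (at x) w - h x u v *\<^sub>R S x w =
      \<Gamma> x u (\<Gamma> x w v) + frechet_derivative (\<lambda>y. \<Gamma> y w v) (at x) u - h x w v *\<^sub>R S x u"
    and codazzi_equation: "h x w (\<Gamma> x u v) + frechet_derivative (\<lambda>y. h y u v) (at x) w =
      h x u (\<Gamma> x w v) + frechet_derivative (\<lambda>y. h y w v) (at x) u"
  using frame_inject[OF assms third_derivative_commute[OF assms, where u = u and v = v and w = w, unfolded third_derivative[OF assms]]]
  by auto

end

text \<open>On constant fields the bracket in the torsion axiom and the derivative of the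
  coefficient in the Leibniz rule are zero.\<close>

lemma levi_civita_const:
  assumes L: "levi_civita V h L" and x: "x \<in> V"
  shows "L (\<lambda>_. u) (\<lambda>_. v) x = L (\<lambda>_. v) (\<lambda>_. u) x"
    and "frechet_derivative (\<lambda>y. h y u v) (at x) w = h x (L (\<lambda>_. w) (\<lambda>_. u) x) v + h x u (L (\<lambda>_. w) (\<lambda>_. v) x)"
    and "linear (\<lambda>v. L (\<lambda>_. u) (\<lambda>_. v) x)"
proof -
  have "L (\<lambda>_. u) (\<lambda>_. v) x - L (\<lambda>_. v) (\<lambda>_. u) x = lie_bracket (\<lambda>_. u) (\<lambda>_. v) x"
    using L x smooth_on_const unfolding levi_civita_def by blast
  then show "L (\<lambda>_. u) (\<lambda>_. v) x = L (\<lambda>_. v) (\<lambda>_. u) x"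
    by (simp add: lie_bracket_def)
  have "\<forall>X Y Z. smooth_on V X \<and> smooth_on V Y \<and> smooth_on V Z \<longrightarrow>
       (\<forall>x\<in>V. frechet_derivative (\<lambda>y. h y (Y y) (Z y)) (at x) (X x) =
          h x (L X Y x) (Z x) + h x (Y x) (L X Z x))"
    using L unfolding levi_civita_def by blast
  from this[rule_format, OF conjI[OF smooth_on_const conjI[OF smooth_on_const smooth_on_const]] x]
  show "frechet_derivative (\<lambda>y. h y u v) (at x) w = h x (L (\<lambda>_. w) (\<lambda>_. u) x) v + h x u (L (\<lambda>_. w) (\<lambda>_. v) x)" .
  have L': "affine_connection V L"
    using L unfolding levi_civita_def by blast
  show "linear (\<lambda>v. L (\<lambda>_. u) (\<lambda>_. v) x)"
  proof (rule linearI)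
    fix v v' :: "real^3" and c :: real
    have "\<forall>X Y Y'. smooth_on V X \<and> smooth_on V Y \<and> smooth_on V Y' \<longrightarrow>
       (\<forall>x\<in>V. L X (\<lambda>y. Y y + Y' y) x = L X Y x + L X Y' x)"
      using L' unfolding affine_connection_def by blast
    from this[rule_format, OF conjI[OF smooth_on_const conjI[OF smooth_on_const smooth_on_const]] x]
    show "L (\<lambda>_. u) (\<lambda>_. v + v') x = L (\<lambda>_. u) (\<lambda>_. v) x + L (\<lambda>_. u) (\<lambda>_. v') x" .
    have "\<forall>(a :: real^3 \<Rightarrow> real) X Y. smooth_on V a \<and> smooth_on V X \<and> smooth_on V Y \<longrightarrow>
       (\<forall>x\<in>V. L (\<lambda>y. a y *\<^sub>R X y) Y x = a x *\<^sub>R L X Y x \<and>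
          L X (\<lambda>y. a y *\<^sub>R Y y) x =
            a x *\<^sub>R L X Y x + frechet_derivative a (at x) (X x) *\<^sub>R Y x)"
      using L' unfolding affine_connection_def by blast
    from this[rule_format, OF conjI[OF smooth_on_const conjI[OF smooth_on_const smooth_on_const]] x]
    show "L (\<lambda>_. u) (\<lambda>_. c *\<^sub>R v) x = c *\<^sub>R L (\<lambda>_. u) (\<lambda>_. v) x"
      by simp
  qed
qed

section \<open>Symmetries of the difference tensor and the shape operator for
  \<open>K = 0\<close>\<close>

context hypersurface_chart
begin

lemma difference_tensor_linear:
  assumes L: "levi_civita V h L" and x: "x \<in> V"
  shows "linear (difference_tensor f \<xi> L x u)"
proof -
  have "linear (\<lambda>v. \<Gamma> x u v - L (\<lambda>_. u) (\<lambda>_. v) x)"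
    by (intro linear_compose_sub linear_\<Gamma>_h2[OF x] levi_civita_const[OF L x])
  then show ?thesis by (simp add: \<Gamma>_def difference_tensor_def[abs_def])
qed

lemma difference_tensor_commute:
  assumes L: "levi_civita V h L" and x: "x \<in> V"
  shows "difference_tensor f \<xi> L x u v = difference_tensor f \<xi> L x v u"
  using \<Gamma>_h_commute(1)[OF x, of u v] levi_civita_const(1)[OF L x, of u v]
  by (simp add: \<Gamma>_def difference_tensor_def)

text \<open>In the Codazzi equation put \<Gamma> = K + L and expand the derivatives of
  \<open>h\<close> by metric compatibility. All terms with \<open>L\<close> cancel, because
  \<open>L\<close> is symmetric on constant fields, and h(w, K(u,v)) = h(u, K(w,v)) remains.\<close>

lemma difference_tensor_totally_symmetric:
  assumes L: "levi_civita V h L" and x: "x \<in> V"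
  shows "h x (difference_tensor f \<xi> L x u v) w = h x (difference_tensor f \<xi> L x w v) u"
proof -
  have K: "\<Gamma> x u v = difference_tensor f \<xi> L x u v + L (\<lambda>_. u) (\<lambda>_. v) x" for u v
    by (simp add: \<Gamma>_def difference_tensor_def)
  show ?thesis
    using codazzi_equation[OF x, of w u v]
    unfolding levi_civita_const(2)[OF L x] K linear_add[OF linear_\<Gamma>_h2(2)[OF x]]
      levi_civita_const(1)[OF L x, of u w] \<Gamma>_h_commute(2)[OF x, of "difference_tensor f \<xi> L x u v"]
      \<Gamma>_h_commute(2)[OF x, of "difference_tensor f \<xi> L x w v"]
    by (simp add: \<Gamma>_h_commute(2)[OF x])
qed

text \<open>
  If \<open>K = 0\<close>, the connection \<open>\<Gamma>\<close> is metric, so its curvature is skew: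
  \<open>h (R(w, u) v, v)\<close> is the commutator of second derivatives of the function \<open>h v v\<close>.
  The Gauss equation turns this into an identity for \<open>S\<close>.
\<close>

lemma shape_identity:
  assumes L: "levi_civita V h L" and K: "\<And>x u v. x \<in> V \<Longrightarrow> difference_tensor f \<xi> L x u v = 0"
    and x: "x \<in> V"
  shows "h x u v * h x (S x w) v = h x w v * h x (S x u) v"
proof -
  \<comment> \<open>Needed at all points of \<open>V\<close> and not only at x, since this formula
    is differentiated once more below.\<close>
  have metric: "frechet_derivative (\<lambda>y. h y u v) (at x) w = h x (\<Gamma> x w u) v + h x u (\<Gamma> x w v)"
    if "x \<in> V" for x u v w
    using levi_civita_const(2)[OF L that] K[OF that] by (simp add: \<Gamma>_def difference_tensor_def)
  have first: "frechet_derivative (\<lambda>y. h y v v) (at y) u = 2 * h y (\<Gamma> y u v) v" if "y \<in> V" for y u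
    using metric[OF that] \<Gamma>_h_commute(2)[OF that] by simp
  have product: "(\<lambda>y. h y (\<Gamma> y u v) v) differentiable (at x)"
    "frechet_derivative (\<lambda>y. h y (\<Gamma> y u v) v) (at x) w =
      frechet_derivative (\<lambda>y. h y (\<Gamma> x u v) v) (at x) w + h x (frechet_derivative (\<lambda>y. \<Gamma> y u v) (at x) w) v" for u w
    using frechet_derivative_bilinear_apply[of V x "\<lambda>y c. h y c v", OF open_V x linear_\<Gamma>_h1(2)
        differentiable_\<Gamma>_h(2)[OF x] differentiable_\<Gamma>_h(1)[OF x]] by auto
  have diff: "(\<lambda>y. frechet_derivative (\<lambda>y. h y v v) (at y) u) differentiable (at x)" for u
    by (rule differentiable_cong_open[OF open_V x first]) (use product(1) in auto)
  have second: "frechet_derivative (\<lambda>y. frechet_derivative (\<lambda>y. h y v v) (at y) u) (at x) w =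
      2 * (h x (\<Gamma> x w (\<Gamma> x u v)) v + h x (\<Gamma> x u v) (\<Gamma> x w v) + h x (frechet_derivative (\<lambda>y. \<Gamma> y u v) (at x) w) v)" for u w
  proof -
    have "((\<lambda>y. 2 * h y (\<Gamma> y u v) v) has_derivative
       (\<lambda>w. 2 * frechet_derivative (\<lambda>y. h y (\<Gamma> y u v) v) (at x) w)) (at x)"
      using product(1)[of u] unfolding frechet_derivative_works by (intro has_derivative_mult_right)
    from fun_cong[OF frechet_derivative_at[OF this, symmetric], of w]
    have "frechet_derivative (\<lambda>y. 2 * h y (\<Gamma> y u v) v) (at x) w =
      2 * (h x (\<Gamma> x w (\<Gamma> x u v)) v + h x (\<Gamma> x u v) (\<Gamma> x w v) + h x (frechet_derivative (\<lambda>y. \<Gamma> y u v) (at x) w) v)"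
      unfolding product(2) metric[OF x] by simp
    moreover have "frechet_derivative (\<lambda>y. frechet_derivative (\<lambda>y. h y v v) (at y) u) (at x) =
      frechet_derivative (\<lambda>y. 2 * h y (\<Gamma> y u v) v) (at x)"
      by (rule frechet_derivative_cong_open[OF open_V x first])
    ultimately show ?thesis by simp
  qed
  have "frechet_derivative (\<lambda>y. frechet_derivative (\<lambda>y. h y v v) (at y) u) (at x) w =
    frechet_derivative (\<lambda>y. frechet_derivative (\<lambda>y. h y v v) (at y) w) (at x) u"
    by (rule mixed_derivatives_commute[OF open_V x _ diff diff]) (rule differentiable_\<Gamma>_h(2))
  \<comment> \<open>The term h(\<Gamma>(u,v), \<Gamma>(w,v)) is symmetric in u and w and drops out.
    Comparison with the Gauss equation paired with v then leaves only the terms with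
    \<open>S\<close>.\<close>
  then have "h x (\<Gamma> x w (\<Gamma> x u v)) v + h x (frechet_derivative (\<lambda>y. \<Gamma> y u v) (at x) w) v =
     h x (\<Gamma> x u (\<Gamma> x w v)) v + h x (frechet_derivative (\<lambda>y. \<Gamma> y w v) (at x) u) v"
    unfolding second using \<Gamma>_h_commute(2)[OF x, of "\<Gamma> x u v" "\<Gamma> x w v"] by simp
  moreover have "h x (\<Gamma> x w (\<Gamma> x u v)) v + h x (frechet_derivative (\<lambda>y. \<Gamma> y u v) (at x) w) v - h x u v * h x (S x w) v =
     h x (\<Gamma> x u (\<Gamma> x w v)) v + h x (frechet_derivative (\<lambda>y. \<Gamma> y w v) (at x) u) v - h x w v * h x (S x u) v"
    using arg_cong[OF gauss_equation[OF x, of w u v], of "\<lambda>t. h x t v"]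
    by (simp add: linear_add[OF linear_\<Gamma>_h1(2)[OF x]] linear_diff[OF linear_\<Gamma>_h1(2)[OF x]]
        linear_scale[OF linear_\<Gamma>_h1(2)[OF x]])
  ultimately show ?thesis by simp
qed

end

section \<open>Invariant cubic forms and isometries\<close>

lemma subspace_dim_1_line:
  fixes l :: "'a::euclidean_space set"
  assumes "subspace l" "dim l = 1"
  obtains a where "a \<noteq> 0" "l = range (\<lambda>c. c *\<^sub>R a)"
proof -
  obtain B where B: "B \<subseteq> l" "independent B" "l \<subseteq> span B" "card B = dim l"
    using basis_exists by blast
  then obtain a where "B = {a}"
    using assms(2) card_1_singletonE by metis
  moreover have "span B = l"
    using B assms(1) by (simp add: span_minimal subset_antisym)
  ultimately have "a \<noteq> 0" "l = range (\<lambda>c. c *\<^sub>R a)"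
    using B(2) dependent_zero[of B] by (auto simp: span_singleton)
  with that show ?thesis by blast
qed

locale inner_form =
  fixes b :: "real^3 \<Rightarrow> real^3 \<Rightarrow> real"
  assumes linear_left: "linear (\<lambda>u. b u v)"
    and commute: "b u v = b v u"
    and positive: "u \<noteq> 0 \<Longrightarrow> b u u > 0"
begin

lemma add_left: "b (u + u') v = b u v + b u' v"
  and scale_left: "b (c *\<^sub>R u) v = c * b u v"
  and diff_left: "b (u - u') v = b u v - b u' v"
  and minus_left: "b (- u) v = - b u v"
  and zero_left: "b 0 v = 0"
  by (simp_all add: linear_add[OF linear_left] linear_scale[OF linear_left]
      linear_diff[OF linear_left] linear_neg[OF linear_left] linear_0[OF linear_left])

lemma add_right: "b v (u + u') = b v u + b v u'"
  and scale_right: "b v (c *\<^sub>R u) = c * b v u"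
  and diff_right: "b v (u - u') = b v u - b v u'"
  and minus_right: "b v (- u) = - b v u"
  and zero_right: "b v 0 = 0"
  by (simp_all add: commute[of v] add_left scale_left diff_left minus_left zero_left)

lemmas bilinear_simps = add_left scale_left diff_left minus_left zero_left
  add_right scale_right diff_right minus_right zero_right

lemma eqI: "(\<And>w. b u w = b v w) \<Longrightarrow> u = v"
  using positive[of "u - v"] by (force simp: diff_left)

lemma scalar_operatorI:
  assumes S: "\<And>u v w. b u v * b (S w) v = b w v * b (S u) v"
  shows "\<exists>k. \<forall>u. S u = k *\<^sub>R u"
proof -
  define k where "k v = b (S v) v / b v v" for v
  \<comment> \<open>The hypothesis with first argument v: every v is an eigenvector of the adjoint
    of \<open>S\<close>, with eigenvalue \<open>k v\<close>. It remains to see that \<open>k\<close>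
    is constant.\<close>
  have Sk: "b (S u) v = k v * b u v" for u v
  proof (cases "v = 0")
    case False
    then show ?thesis
      using S[of v v u] positive[OF False] by (simp add: k_def field_simps)
  qed (simp add: bilinear_simps)
  txt \<open>\<open>b (S w)\<close> is additive in its second slot, which forces the factors \<open>k\<close> to agree.\<close>
  have perp: "k u = k v" if "u \<noteq> 0" "v \<noteq> 0" "b u v = 0" for u v
  proof -
    have "k (u + v) * b w (u + v) = k u * b w u + k v * b w v" for w
      unfolding Sk[symmetric] by (simp add: bilinear_simps)
    from this[of u] this[of v] have "k (u + v) = k u" "k (u + v) = k v"
      using that positive[of u] positive[of v] commute[of v u] by (simp_all add: bilinear_simps)
    then show ?thesis by simp
  qed
  obtain e :: "real^3" where e: "e \<noteq> 0"
    using vec_eq_iff by (metis one_neq_zero one_index zero_index)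
  have "S u = k e *\<^sub>R u" for u
  proof (rule eqI)
    fix w
    \<comment> \<open>\<open>perp\<close> compares \<open>k\<close> only at orthogonal vectors, so w
      is split into a multiple of e and a part orthogonal to e.\<close>
    define c where "c = b w e / b e e"
    define v where "v = w - c *\<^sub>R e"
    have "b v e = 0"
      using positive[OF e] by (simp add: v_def c_def bilinear_simps)
    then have "b (S u) v = k e * b u v"
      using perp[of v e] e Sk[of u v] by (cases "v = 0") (simp_all add: bilinear_simps)
    moreover have "w = v + c *\<^sub>R e" by (simp add: v_def)
    ultimately show "b (S u) w = b (k e *\<^sub>R u) w"
      using Sk[of u e] by (simp add: bilinear_simps algebra_simps)
  qed
  then show ?thesis by blast
qed

text \<open>A \<open>b\<close>-orthonormal frame seen as an isometry from the standard Euclidean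
  space, so that rotations can be written in standard coordinates and conjugated.\<close>

definition frame_iso :: "(real^3 \<Rightarrow> real^3) \<Rightarrow> bool"
  where "frame_iso P \<longleftrightarrow> linear P \<and> (\<forall>u v. b (P u) (P v) = u \<bullet> v)"

lemma frame_iso_bij:
  assumes "frame_iso P"
  shows "inj P" "surj P" "linear (inv_into UNIV P)" "P (inv_into UNIV P u) = u" "inv_into UNIV P (P u) = u"
proof -
  have lin: "linear P" using assms by (simp add: frame_iso_def)
  show inj: "inj P"
    unfolding linear_injective_0[OF lin]
    using assms by (metis frame_iso_def inner_eq_zero_iff zero_left)
  show surj: "surj P"
    by (rule linear_injective_imp_surjective[OF lin inj]) simp
  show "linear (inv_into UNIV P)"
    using inj_linear_imp_inv_linear lin inj by blast
  show "P (inv_into UNIV P u) = u" "inv_into UNIV P (P u) = u"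
    using inj surj by (simp_all add: surj_f_inv_f)
qed

text \<open>Conjugation preserves the determinant whatever the sign of
  \<open>det (matrix P)\<close>.\<close>

lemma conjugate_oriented_isometry:
  assumes P: "frame_iso P" and T: "linear T" "det (matrix T) = 1" "\<And>u v. T u \<bullet> T v = u \<bullet> v"
  shows "P \<circ> T \<circ> inv_into UNIV P \<in> oriented_isometries b"
proof -
  have lin: "linear P" "linear (inv_into UNIV P)"
    using P frame_iso_bij[OF P] by (simp_all add: frame_iso_def)
  have "matrix P ** matrix (inv_into UNIV P) = mat 1"
    using matrix_compose[OF lin(2,1)] frame_iso_bij(2)[OF P] by (simp add: surj_iff matrix_id_mat_1)
  then have "det (matrix P) * det (matrix (inv_into UNIV P)) = 1"
    by (metis det_I det_mul)
  then have "det (matrix (P \<circ> T \<circ> inv_into UNIV P)) = 1"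
    using lin T by (simp add: matrix_compose linear_compose det_mul)
  moreover have "b ((P \<circ> T \<circ> inv_into UNIV P) u) ((P \<circ> T \<circ> inv_into UNIV P) v) = b u v" for u v
  proof -
    have "b u v = b (P (inv_into UNIV P u)) (P (inv_into UNIV P v))"
      by (simp add: frame_iso_bij(4)[OF P])
    then show ?thesis
      using P T(3) by (simp add: frame_iso_def)
  qed
  moreover have "linear (P \<circ> T \<circ> inv_into UNIV P)"
    by (intro linear_compose lin T)
  ultimately show ?thesis
    by (simp add: oriented_isometries_def)
qed

lemma orthonormal_frame_iso:
  assumes "b e1 e1 = 1" "b e2 e2 = 1" "b e3 e3 = 1" "b e1 e2 = 0" "b e1 e3 = 0" "b e2 e3 = 0"
  shows "frame_iso (\<lambda>z. (z $ 1) *\<^sub>R e1 + (z $ 2) *\<^sub>R e2 + (z $ 3) *\<^sub>R e3)" (is "frame_iso ?P")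
proof -
  have "linear ?P"
    by (rule linearI) (simp_all add: algebra_simps)
  moreover have "b (?P u) (?P v) = u \<bullet> v" for u v
    using assms commute[of e2 e1] commute[of e3 e1] commute[of e3 e2]
    by (simp add: bilinear_simps inner_vec_def sum_3 algebra_simps)
  ultimately show ?thesis by (simp add: frame_iso_def)
qed

lemma normalize: "u \<noteq> 0 \<Longrightarrow> b ((1 / sqrt (b u u)) *\<^sub>R u) ((1 / sqrt (b u u)) *\<^sub>R u) = 1"
  using positive[of u] by (simp add: bilinear_simps)

text \<open>A Gram-Schmidt step on a vector outside the plane of e1 and e2, which exists in
  dimension 3.\<close>

lemma extend_orthonormal:
  assumes e: "b e1 e1 = 1" "b e2 e2 = 1" "b e1 e2 = 0"
  obtains e3 where "b e3 e3 = 1" "b e1 e3 = 0" "b e2 e3 = 0"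
proof -
  have "dim (span {e1, e2}) \<le> card {e1, e2}"
    by (intro dim_le_card) auto
  also have "\<dots> \<le> 2"
    by (simp add: card_insert_if)
  finally have "span {e1, e2} \<noteq> UNIV"
    using dim_UNIV[where 'a = "real^3"] by fastforce
  then obtain w where w: "w \<notin> span {e1, e2}" by blast
  define v where "v = w - b w e1 *\<^sub>R e1 - b w e2 *\<^sub>R e2"
  have "v \<noteq> 0"
  proof
    assume "v = 0"
    then have "w = b w e1 *\<^sub>R e1 + b w e2 *\<^sub>R e2" by (simp add: v_def algebra_simps)
    moreover have "\<dots> \<in> span {e1, e2}"
      by (intro span_add span_scale span_base) auto
    ultimately show False using w by simp
  qed
  moreover have "b e1 v = 0" "b e2 v = 0"
    using e commute[of e2 e1] commute[of w e1] commute[of w e2] by (simp_all add: v_def bilinear_simps)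
  ultimately show ?thesis
    using that[of "(1 / sqrt (b v v)) *\<^sub>R v"] normalize[of v] by (simp add: bilinear_simps)
qed

text \<open>Take e1 on \<open>l\<close>, e2 on the axis of the half turn, and e3 orthogonal to both;
  the half turn is -1 on the orthogonal complement of its axis, which contains e1 and e3.\<close>

lemma Z2_SO2_frame:
  assumes G: "is_Z2_SO2 b G"
  obtains l r e1 e2 e3
  where "G = generate (BijGroup UNIV) (rotations_about b l \<union> {r})" "l = range (\<lambda>c. c *\<^sub>R e1)"
    "b e1 e1 = 1" "b e2 e2 = 1" "b e3 e3 = 1" "b e1 e2 = 0" "b e1 e3 = 0" "b e2 e3 = 0"
    "linear r" "r e1 = - e1" "r e2 = e2" "r e3 = - e3"
proof -
  obtain l m r where lm: "subspace l" "dim l = 1" "subspace m" "dim m = 1"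
      "\<And>u v. u \<in> l \<Longrightarrow> v \<in> m \<Longrightarrow> b u v = 0" "half_turn_about b m r"
    and gen: "G = generate (BijGroup UNIV) (rotations_about b l \<union> {r})"
    using G unfolding is_Z2_SO2_def by blast
  have unit: "\<exists>e. b e e = 1 \<and> l = range (\<lambda>c. c *\<^sub>R e)" if l: "subspace l" "dim l = 1" for l
  proof -
    obtain a where a: "a \<noteq> 0" "l = range (\<lambda>c. c *\<^sub>R a)"
      using subspace_dim_1_line[OF l] .
    define s where "s = sqrt (b a a)"
    have s: "s > 0" using positive[OF a(1)] by (simp add: s_def)
    have "range (\<lambda>c. c *\<^sub>R a) = range (\<lambda>c. c *\<^sub>R ((1 / s) *\<^sub>R a))"
    proof (intro subset_antisym image_subsetI)
      fix c
      show "c *\<^sub>R a \<in> range (\<lambda>c. c *\<^sub>R ((1 / s) *\<^sub>R a))"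
        using s by (intro range_eqI[of _ _ "c * s"]) simp
      show "c *\<^sub>R ((1 / s) *\<^sub>R a) \<in> range (\<lambda>c. c *\<^sub>R a)"
        by (rule range_eqI[of _ _ "c / s"]) simp
    qed
    then show ?thesis
      using normalize[OF a(1)] a(2) unfolding s_def by metis
  qed
  obtain e1 where e1: "b e1 e1 = 1" "l = range (\<lambda>c. c *\<^sub>R e1)"
    using unit lm by blast
  obtain e2 where e2: "b e2 e2 = 1" "m = range (\<lambda>c. c *\<^sub>R e2)"
    using unit lm by blast
  have in_l: "e1 \<in> l" and in_m: "e2 \<in> m"
    using e1 e2 by (auto intro: range_eqI[of _ _ 1])
  then have b12: "b e1 e2 = 0" using lm(5) by blast
  obtain e3 where e3: "b e3 e3 = 1" "b e1 e3 = 0" "b e2 e3 = 0"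
    using extend_orthonormal[OF e1(1) e2(1) b12] .
  have turn: "r u = - u" if "b u e2 = 0" for u
    using lm(6) that unfolding half_turn_about_def e2(2) by (auto simp: bilinear_simps)
  have "linear r" "r e2 = e2"
    using lm(6) in_m unfolding half_turn_about_def by auto
  moreover have "r e1 = - e1" "r e3 = - e3"
    using turn b12 e3(3) commute[of e3 e2] by auto
  ultimately show ?thesis
    using that[OF gen e1(2,1) e2(1) e3(1) b12 e3(2,3)] by blast
qed

lemma oriented_isometry_bij: "g \<in> oriented_isometries b \<Longrightarrow> bij g"
proof -
  assume g: "g \<in> oriented_isometries b"
  then have lin: "linear g" by (simp add: oriented_isometries_def)
  have "inj g"
    unfolding linear_injective_0[OF lin]
  proof (intro allI impI)
    fix u assume "g u = 0"
    moreover have "b (g u) (g u) = b u u" using g by (simp add: oriented_isometries_def)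
    ultimately show "u = 0" using positive[of u] by (auto simp: bilinear_simps)
  qed
  then show "bij g"
    using linear_injective_imp_surjective[OF lin] by (simp add: bij_def)
qed

end

text \<open>Bijectivity is carried through the induction because multiplication and inverse in
  \<open>BijGroup UNIV\<close> are composition and inverse function only on bijections.\<close>

lemma generate_preserves_set:
  assumes "\<And>g. g \<in> H \<Longrightarrow> bij g \<and> g ` A = A" and "g \<in> generate (BijGroup UNIV) H"
  shows "bij g \<and> g ` A = A"
  using assms(2)
proof induction
  case one
  then show ?case using bij_id by (simp add: BijGroup_def id_def)
next
  case (incl h)
  then show ?case using assms(1) by blast
next
  case (inv h)
  then have h: "bij h" "h ` A = A" using assms(1) by blast+
  then have "inv\<^bsub>BijGroup UNIV\<^esub> h = inv_into UNIV h"
    by (simp add: inv_BijGroup Bij_def restrict_def)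
  moreover have "inv_into UNIV h ` A = A"
    using h by (metis bij_is_inj image_inv_f_f)
  ultimately show ?case using h by (simp add: bij_imp_bij_inv)
next
  case (eng h1 h2)
  then have "h1 \<otimes>\<^bsub>BijGroup UNIV\<^esub> h2 = h1 \<circ> h2"
    by (auto simp: BijGroup_def Bij_def compose_def)
  moreover have "bij (h1 \<circ> h2)"
    using eng by (blast intro: bij_comp)
  moreover have "(h1 \<circ> h2) ` A = A"
    using eng image_comp[of h1 h2 A] by metis
  ultimately show ?case by metis
qed

text \<open>Rotation by pi/2 about the first axis, the one rotation about \<open>l\<close> that the
  cubic form is tested on.\<close>

definition quarter_turn :: "real^3 \<Rightarrow> real^3"
  where "quarter_turn z = vector [z $ 1, - z $ 3, z $ 2]"

text \<open>Rotation by 2 pi/3 about the diagonal, taking the first axis to the second; it supplies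
  an isometry that does not preserve \<open>l\<close>.\<close>

definition cyclic_shift :: "real^3 \<Rightarrow> real^3"
  where "cyclic_shift z = vector [z $ 3, z $ 1, z $ 2]"

lemma quarter_turn: "linear quarter_turn" "det (matrix quarter_turn) = 1"
    "quarter_turn u \<bullet> quarter_turn v = u \<bullet> v"
  by (auto intro!: linearI simp: quarter_turn_def vec_eq_iff forall_3 det_3 matrix_def axis_def inner_vec_def sum_3)

lemma cyclic_shift: "linear cyclic_shift" "det (matrix cyclic_shift) = 1"
    "cyclic_shift u \<bullet> cyclic_shift v = u \<bullet> v"
  by (auto intro!: linearI simp: cyclic_shift_def vec_eq_iff forall_3 det_3 matrix_def axis_def inner_vec_def sum_3)

section \<open>What the prescribed symmetry group forces on \<open>K\<close> and excludes for
  \<open>S\<close>\<close>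

context inner_form
begin

lemma rotation_images:
  fixes e1 e2 e3 :: "real^3"
  assumes "b e1 e1 = 1" "b e2 e2 = 1" "b e3 e3 = 1" "b e1 e2 = 0" "b e1 e3 = 0" "b e2 e3 = 0"
  obtains \<rho> \<sigma> where "\<rho> \<in> oriented_isometries b" "\<rho> e1 = e1" "\<rho> e2 = e3" "\<rho> e3 = - e2"
    "\<sigma> \<in> oriented_isometries b" "\<sigma> e1 = e2"
proof -
  define P where "P z = (z $ 1) *\<^sub>R e1 + (z $ 2) *\<^sub>R e2 + (z $ 3) *\<^sub>R e3" for z :: "real^3"
  have P: "frame_iso P"
    using orthonormal_frame_iso[OF assms] unfolding P_def .
  have "P (vector [1, 0, 0]) = e1" "P (vector [0, 1, 0]) = e2" "P (vector [0, 0, 1]) = e3"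
    by (simp_all add: P_def)
  then have inv: "inv_into UNIV P e1 = vector [1, 0, 0]" "inv_into UNIV P e2 = vector [0, 1, 0]" "inv_into UNIV P e3 = vector [0, 0, 1]"
    using frame_iso_bij(5)[OF P] by metis+
  define \<rho> where "\<rho> = P \<circ> quarter_turn \<circ> inv_into UNIV P"
  define \<sigma> where "\<sigma> = P \<circ> cyclic_shift \<circ> inv_into UNIV P"
  have "\<rho> \<in> oriented_isometries b" "\<sigma> \<in> oriented_isometries b"
    unfolding \<rho>_def \<sigma>_def
    by (rule conjugate_oriented_isometry[OF P quarter_turn] conjugate_oriented_isometry[OF P cyclic_shift])+
  moreover have "\<rho> e1 = e1" "\<rho> e2 = e3" "\<rho> e3 = - e2" "\<sigma> e1 = e2"
    by (simp_all add: \<rho>_def \<sigma>_def inv P_def quarter_turn_def cyclic_shift_def)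
  ultimately show ?thesis
    using that by blast
qed

text \<open>Let x be the coordinate along \<open>l\<close> and y, z the others. Cubics fixed by the
  quarter turn are spanned by x^3 and x(y^2 + z^2): its square excludes odd degree in y, z, and it
  negates yz and y^2 - z^2. The half turn negates both survivors.\<close>

lemma Z2_SO2_invariant_cubic_zero:
  assumes G: "is_Z2_SO2 b (symmetry_group b K S)"
    and K: "\<And>u. linear (K u)" "\<And>u v. K u v = K v u" "\<And>u v w. b (K u v) w = b (K w v) u"
  shows "K u v = 0"
proof -
  obtain l r e1 e2 e3 where gen: "symmetry_group b K S = generate (BijGroup UNIV) (rotations_about b l \<union> {r})"
    and l: "l = range (\<lambda>c. c *\<^sub>R e1)"
    and e: "b e1 e1 = 1" "b e2 e2 = 1" "b e3 e3 = 1" "b e1 e2 = 0" "b e1 e3 = 0" "b e2 e3 = 0"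
    and r: "linear r" "r e1 = - e1" "r e2 = e2" "r e3 = - e3"
    using Z2_SO2_frame[OF G] by metis
  obtain \<rho> where \<rho>: "\<rho> \<in> oriented_isometries b" "\<rho> e1 = e1" "\<rho> e2 = e3" "\<rho> e3 = - e2"
    using rotation_images[OF e] by metis
  have lin\<rho>: "linear \<rho>" using \<rho>(1) by (simp add: oriented_isometries_def)
  have "\<rho> \<in> rotations_about b l"
    using \<rho> lin\<rho> unfolding rotations_about_def l by (auto simp: linear_scale)
  then have sym: "\<rho> \<in> symmetry_group b K S" "r \<in> symmetry_group b K S"
    unfolding gen by (auto intro: generate.incl)
  define C where "C u v w = b (K u v) w" for u v w
  have inv: "C (g u) (g v) (g w) = C u v w" if "g \<in> symmetry_group b K S" for g u v w
    using that by (simp add: C_def symmetry_group_def oriented_isometries_def)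
  have C_sym: "C u v w = C v u w" "C u v w = C w v u" for u v w
    using K(2)[of u v] K(3)[of u v w] by (simp_all add: C_def)
  have neg3: "C u v (- w) = - C u v w" for u v w
    by (simp add: C_def bilinear_simps)
  have neg1: "C (- u) v w = - C u v w" for u v w
    using neg3[of w v u] C_sym(2)[of "- u" v w] C_sym(2)[of w v u] by simp
  have neg2: "C u (- v) w = - C u v w" for u v w
    using neg1[of v u w] C_sym(1)[of u "- v" w] C_sym(1)[of v u w] by simp
  note I\<rho> = inv[OF sym(1)] and Ir = inv[OF sym(2)]
  note neg = neg1 neg2 neg3
  have c111: "C e1 e1 e1 = 0" using Ir[of e1 e1 e1] by (simp add: r neg)
  have c112: "C e1 e1 e2 = 0" "C e1 e1 e3 = 0"
    using I\<rho>[of e1 e1 e2] I\<rho>[of e1 e1 e3] by (simp_all add: \<rho> neg)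
  have c122: "C e1 e2 e2 = 0" "C e1 e3 e3 = 0"
    using Ir[of e1 e2 e2] Ir[of e1 e3 e3] by (simp_all add: r neg)
  have c123: "C e1 e2 e3 = 0"
    using I\<rho>[of e1 e2 e3] C_sym(1)[of e1 e3 e2] C_sym(2)[of e3 e1 e2] C_sym(1)[of e2 e1 e3] by (simp add: \<rho> neg)
  have c222: "C e2 e2 e2 = 0" "C e3 e3 e3 = 0"
    using I\<rho>[of e2 e2 e2] I\<rho>[of e3 e3 e3] by (simp_all add: \<rho> neg)
  \<comment> \<open>The quarter turn gives C(e2,e2,e3) = -C(e3,e3,e2) from the first triple and
    C(e3,e3,e2) = C(e2,e2,e3) from the second.\<close>
  have c223: "C e2 e2 e3 = 0" "C e3 e3 e2 = 0"
    using I\<rho>[of e2 e2 e3] I\<rho>[of e3 e3 e2] by (simp_all add: \<rho> neg)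
  have P: "frame_iso (\<lambda>z. (z $ 1) *\<^sub>R e1 + (z $ 2) *\<^sub>R e2 + (z $ 3) *\<^sub>R e3)"
    by (rule orthonormal_frame_iso[OF e])
  have expand: "\<exists>c1 c2 c3. u = c1 *\<^sub>R e1 + c2 *\<^sub>R e2 + c3 *\<^sub>R e3" for u
    using surjD[OF frame_iso_bij(2)[OF P], of u] by blast
  have zeroI: "t = 0" if "b t e1 = 0" "b t e2 = 0" "b t e3 = 0" for t
  proof (rule eqI)
    fix w
    show "b t w = b 0 w"
      using expand[of w] that by (auto simp: bilinear_simps)
  qed
  have 1: "C e1 e2 e1 = 0" "C e1 e3 e1 = 0" "C e1 e3 e2 = 0" "C e2 e2 e1 = 0" "C e2 e3 e1 = 0"
    "C e2 e3 e2 = 0" "C e2 e3 e3 = 0" "C e3 e3 e1 = 0"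
    using c112 c122 c123 c223 C_sym(2)[of e1 e2 e1] C_sym(2)[of e1 e3 e1] C_sym(1)[of e2 e1 e1]
      C_sym(1)[of e3 e1 e1] C_sym
    by metis+
  have zero: "K e1 e1 = 0" "K e1 e2 = 0" "K e1 e3 = 0" "K e2 e2 = 0" "K e2 e3 = 0" "K e3 e3 = 0"
    using c111 c112 c122 c123 c222 c223 1 unfolding C_def by (auto intro!: zeroI)
  have zero': "K e2 e1 = 0" "K e3 e1 = 0" "K e3 e2 = 0"
    using zero K(2)[of e2 e1] K(2)[of e3 e1] K(2)[of e3 e2] by simp_all
  have lin: "K u (c1 *\<^sub>R e1 + c2 *\<^sub>R e2 + c3 *\<^sub>R e3) = c1 *\<^sub>R K u e1 + c2 *\<^sub>R K u e2 + c3 *\<^sub>R K u e3" for u c1 c2 c3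
    by (simp add: linear_add[OF K(1)] linear_scale[OF K(1)])
  have *: "K e1 u = 0" "K e2 u = 0" "K e3 u = 0" for u
    using expand[of u] zero zero' by (auto simp: lin)
  then have "K u e1 = 0" "K u e2 = 0" "K u e3 = 0" for u
    using K(2)[of u] by simp_all
  then show "K u v = 0"
    using expand[of v] by (auto simp: lin)
qed

lemma Z2_SO2_not_scalar:
  assumes G: "is_Z2_SO2 b (symmetry_group b K S)"
    and K: "\<And>u v. K u v = 0" and S: "\<And>u. S u = k *\<^sub>R u"
  shows False
proof -
  have all: "symmetry_group b K S = oriented_isometries b"
    unfolding symmetry_group_def using K S
    by (auto simp: oriented_isometries_def linear_0 linear_scale)
  obtain l r e1 e2 e3 where gen: "symmetry_group b K S = generate (BijGroup UNIV) (rotations_about b l \<union> {r})"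
    and l: "l = range (\<lambda>c. c *\<^sub>R e1)"
    and e: "b e1 e1 = 1" "b e2 e2 = 1" "b e3 e3 = 1" "b e1 e2 = 0" "b e1 e3 = 0" "b e2 e3 = 0"
    and r: "linear r" "r e1 = - e1" "r e2 = e2" "r e3 = - e3"
    using Z2_SO2_frame[OF G] by metis
  obtain \<sigma> where \<sigma>: "\<sigma> \<in> oriented_isometries b" "\<sigma> e1 = e2"
    using rotation_images[OF e] by metis
  \<comment> \<open>The two unit vectors on \<open>l\<close> stand for the line: rotations about
    \<open>l\<close> fix e1 and the half turn negates it, while \<sigma> takes e1 to e2.\<close>
  have "bij g \<and> g ` {e1, - e1} = {e1, - e1}" if "g \<in> rotations_about b l \<union> {r}" for g
  proof
    have "g \<in> oriented_isometries b"
      using that generate.incl[of g _ "BijGroup UNIV"] all gen by metis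
    then show "bij g" by (rule oriented_isometry_bij)
    have "e1 \<in> l" using l by (auto intro: range_eqI[of _ _ 1])
    then have "linear g \<and> (g e1 = e1 \<or> g e1 = - e1)"
      using that r by (auto simp: rotations_about_def oriented_isometries_def)
    then show "g ` {e1, - e1} = {e1, - e1}"
      by (auto simp: linear_neg)
  qed
  from generate_preserves_set[OF this, where g = \<sigma>] have "\<sigma> ` {e1, - e1} = {e1, - e1}"
    using \<sigma>(1) all gen by blast
  then have "e2 = e1 \<or> e2 = - e1" using \<sigma>(2) by auto
  then show False
    using e by (auto simp: bilinear_simps)
qed

end

theorem mainTheorem2:
  shows "\<not> (\<exists>(M :: 'a topology) (A :: 'a chart set) (F :: 'a \<Rightarrow> real^4) (\<xi> :: 'a \<Rightarrow> real^4).
    affine_hypersurface M A F \<xi> \<and> positive_definite_hypersurface A F \<xi> \<and>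
    pointwise_Z2_SO2_symmetric A F \<xi>)"
proof
  assume "\<exists>(M :: 'a topology) (A :: 'a chart set) (F :: 'a \<Rightarrow> real^4) (\<xi> :: 'a \<Rightarrow> real^4).
    affine_hypersurface M A F \<xi> \<and> positive_definite_hypersurface A F \<xi> \<and>
    pointwise_Z2_SO2_symmetric A F \<xi>"
  then obtain M :: "'a topology" and A :: "'a chart set" and F \<xi> :: "'a \<Rightarrow> real^4"
    where hyp: "affine_hypersurface M A F \<xi>" and pos: "positive_definite_hypersurface A F \<xi>"
      and sym: "pointwise_Z2_SO2_symmetric A F \<xi>"
    by blast
  have mfd: "smooth_3_manifold M A"
    using hyp unfolding affine_hypersurface_def by blast
  \<comment> \<open>Nonemptiness of the manifold enters here; the remaining conditions hold
    vacuously for an empty atlas.\<close>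
  then have "(\<Union>(U, \<phi>)\<in>A. U) \<noteq> {}"
    unfolding smooth_3_manifold_def by metis
  then obtain c where c: "c \<in> A" "fst c \<noteq> {}"
    by fastforce
  define V where "V = chart_image c"
  define f where "f = in_chart c F"
  define n where "n = in_chart c \<xi>"
  have "open V"
    using mfd c(1) unfolding smooth_3_manifold_def V_def chart_image_def by (auto split: prod.splits)
  moreover have "smooth_on V f" "smooth_on V n" "transversal_immersion V f n" "blaschke_normal V f n"
    using hyp c(1) unfolding affine_hypersurface_def V_def f_def n_def by blast+
  ultimately interpret hypersurface_chart V f n
    by unfold_locales (auto simp: blaschke_normal_def)
  obtain L where L: "levi_civita V h L" and
    sym: "\<And>x. x \<in> V \<Longrightarrow> is_Z2_SO2 (h x) (symmetry_group (h x) (difference_tensor f n L x) (S x))"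
    using sym c(1) unfolding pointwise_Z2_SO2_symmetric_def Let_def V_def f_def n_def by blast
  have form: "inner_form (h x)" if x: "x \<in> V" for x
  proof (rule inner_form.intro)
    show "linear (\<lambda>u. h x u v)" for v by (rule linear_\<Gamma>_h1(2)[OF x])
    show "h x u v = h x v u" for u v by (rule \<Gamma>_h_commute(2)[OF x])
    show "h x u u > 0" if "u \<noteq> 0" for u
      using pos c(1) x that unfolding positive_definite_hypersurface_def V_def f_def n_def by blast
  qed
  have K: "difference_tensor f n L x u v = 0" if x: "x \<in> V" for x u v
    by (rule inner_form.Z2_SO2_invariant_cubic_zero[OF form[OF x] sym[OF x] difference_tensor_linear[OF L x]
          difference_tensor_commute[OF L x] difference_tensor_totally_symmetric[OF L x]])
  obtain x where x: "x \<in> V"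
    using c(2) unfolding V_def chart_image_def by blast
  interpret inner_form "h x" by (rule form[OF x])
  have scal: "h x u v * h x (S x w) v = h x w v * h x (S x u) v" for u v w
    by (rule shape_identity[OF L _ x]) (rule K)
  obtain k where k: "\<And>u. S x u = k *\<^sub>R u"
    using scalar_operatorI[of "S x", OF scal] by blast
  show False
    by (rule Z2_SO2_not_scalar[OF sym[OF x] K[OF x] k])
qed

end
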